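(* Let $n\ge 2$ be an integer, let $\mathcal{A}$ be a unital algebra over a commutative unital ring $\mathcal{R}$ with a nontrivial idempotent $e$, and put $f=1-e$. Suppose that $\mathcal{A}$ is $2$- and $(n-1)$-torsion free, and that for each $x\in\mathcal{A}$: $exe\cdot e\mathcal{A}f=\{0\}=f\mathcal{A}e\cdot exe$ implies $exe=0$, and $e\mathcal{A}f\cdot fxf=\{0\}=fxf\cdot f\mathcal{A}e$ implies $fxf=0$. Suppose that one of the following statements holds: (i-1) $e\mathcal{A}e=\mathcal{S}(e\mathcal{A}e)$ and $f\mathcal{A}f=\mathcal{S}(f\mathcal{A}f)$; (i-2) $e\mathcal{A}e=\mathcal{S}(e\mathcal{A}e)$ and $\mathcal{Z}(e\mathcal{A}e)=e\mathcal{Z}(\mathcal{A})e$; (i-3) $f\mathcal{A}f=\mathcal{S}(f\mathcal{A}f)$ and $\mathcal{Z}(f\mathcal{A}f)=f\mathcal{Z}(\mathcal{A})f$; (i-4) $\mathcal{Z}(e\mathcal{A}e)=e\mathcal{Z}(\mathcal{A})e$ and $\mathcal{Z}(f\mathcal{A}f)=f\mathcal{Z}(\mathcal{A})f$, and, when $n\ge 3$, $e\mathcal{A}e$ or $f\mathcal{A}f$ satisfies property (P) (defined in the context); that one of the following statements also holds: (ii-1) $e\mathcal{A}e$ or $f\mathcal{A}f$ has no nonzero central ideal; (ii-2) $e\mathcal{A}f\cdot f\mathcal{A}e=f\mathcal{A}e\cdot e\mathcal{A}f=\{0\}$; and that (iii) for each $x\in\mathcal{A}$, $exf\cdot f\mathcal{A}e=\{0\}=f\mathcal{A}e\cdot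 exf$ implies $exf=0$, and $e\mathcal{A}f\cdot fxe=\{0\}=fxe\cdot e\mathcal{A}f$ implies $fxe=0$. Then every Lie $n$-derivation on $\mathcal{A}$ is standard.
   Context: Linear means $\mathcal{R}$-linear; $\mathcal{Z}(\cdot)$ denotes the centre. Nontrivial idempotent: $e^2=e$, $e\ne 0,1$. For a positive integer $k$, $\mathcal{A}$ is $k$-torsion free if $kx=0$ implies $x=0$ for each $x\in\mathcal{A}$. $[x,y]=xy-yx$. Define $p_1(x_1)=x_1$ and $p_n(x_1,\dots,x_n)=[p_{n-1}(x_1,\dots,x_{n-1}),x_n]$ for $n\ge2$; for $n\ge 2$, $p_n(x_1,\dots,x_n)$ is called an $(n-1)$-th commutator. A linear map $\varphi:\mathcal{A}\to\mathcal{A}$ is a Lie $n$-derivation if $\varphi(p_n(x_1,\dots,x_n))=\sum_{i=1}^n p_n(x_1,\dots,x_{i-1},\varphi(x_i),x_{i+1},\dots,x_n)$ for all $x_1,\dots,x_n\in\mathcal{A}$. A Lie $n$-derivation is standard if it equals $h+\tau$ with $h$ a derivation on $\mathcal{A}$ (linear, $h(xy)=h(x)y+xh(y)$) and $\tau$ a linear mapping from $\mathcal{A}$ into $\mathcal{Z}(\mathcal{A})$ vanishing on all $(n-1)$-th commutators of $\mathcal{A}$. For an algebra $\mathcal{B}$, $\mathcal{S}(\mathcal{B})$ is the subalgebra of $\mathcal{B}$ generated by all idempotents and all commutators of $\mathcal{B}$; a central ideal of $\mathcal{B}$ is an ideal contained in $\mathcal{Z}(\mathcal{B})$; $\mathcal{B}$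 satisfies property (P) if for each $x\in\mathcal{B}$, $[x,\mathcal{B}]\subseteq\mathcal{Z}(\mathcal{B})$ implies $x\in\mathcal{Z}(\mathcal{B})$. $e\mathcal{A}e$ and $f\mathcal{A}f$ are regarded as unital algebras with units $e$ and $f$. *)

theory Defs
  imports Complex_Main "HOL-Library.Set_Algebras"
begin

text \<open>Products of subsets, such as \<open>{a} * B\<close> or \<open>A * B\<close>, are the elementwise products
  of \<^theory>\<open>HOL-Library.Set_Algebras\<close>.\<close>

text \<open>The class \<open>ring_1\<close> forces \<open>0 \<noteq> 1\<close> in the algebra and in the ring of scalars. An algebra
  with a nontrivial idempotent is nonzero, and so is then the ring of scalars.\<close>

locale unital_algebra = module scale
  for scale :: "'r::comm_ring_1 \<Rightarrow> 'a::ring_1 \<Rightarrow> 'a" +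
  assumes scale_mult_left: "scale r x * y = scale r (x * y)"
    and scale_mult_right: "x * scale r y = scale r (x * y)"

definition torsion_free :: "nat \<Rightarrow> 'a::ring_1 itself \<Rightarrow> bool" where
  "torsion_free k _ \<longleftrightarrow> (\<forall>x::'a. of_nat k * x = 0 \<longrightarrow> x = 0)"

definition lie_bracket :: "'a::ring \<Rightarrow> 'a \<Rightarrow> 'a" where
  "lie_bracket x y = x * y - y * x"

text \<open>\<open>lie_p n x\<close> is the iterated commutator \<open>[\<dots>[[x 1, x 2], x 3], \<dots>, x n]\<close>; it
  depends only on the values of the family \<open>x\<close> at
  \<open>1, \<dots>, n\<close>. The value at \<open>n = 0\<close> is a dummy.\<close>

fun lie_p :: "nat \<Rightarrow> (nat \<Rightarrow> 'a::ring) \<Rightarrow> 'a" where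
  "lie_p 0 x = 0"
| "lie_p (Suc 0) x = x 1"
| "lie_p (Suc (Suc k)) x = lie_bracket (lie_p (Suc k) x) (x (Suc (Suc k)))"

definition center :: "'a::ring set \<Rightarrow> 'a set" where
  "center B = {z \<in> B. \<forall>x\<in>B. z * x = x * z}"

definition corner :: "'a::ring \<Rightarrow> 'a \<Rightarrow> 'a set" where
  "corner a b = {a * x * b | x. True}"

definition lie_n_derivation ::
    "('r::comm_ring_1 \<Rightarrow> 'a::ring_1 \<Rightarrow> 'a) \<Rightarrow> nat \<Rightarrow> ('a \<Rightarrow> 'a) \<Rightarrow> bool" where
  "lie_n_derivation scale n \<phi> \<longleftrightarrow>
     module_hom scale scale \<phi> \<and>
     (\<forall>x. \<phi> (lie_p n x) = (\<Sum>i = 1..n. lie_p n (x(i := \<phi> (x i)))))"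

definition derivation :: "('r::comm_ring_1 \<Rightarrow> 'a::ring_1 \<Rightarrow> 'a) \<Rightarrow> ('a \<Rightarrow> 'a) \<Rightarrow> bool" where
  "derivation scale h \<longleftrightarrow>
     module_hom scale scale h \<and> (\<forall>x y. h (x * y) = h x * y + x * h y)"

definition standard ::
    "('r::comm_ring_1 \<Rightarrow> 'a::ring_1 \<Rightarrow> 'a) \<Rightarrow> nat \<Rightarrow> ('a \<Rightarrow> 'a) \<Rightarrow> bool" where
  "standard scale n \<phi> \<longleftrightarrow>
     (\<exists>h \<tau>. derivation scale h \<and> module_hom scale scale \<tau> \<and>
            range \<tau> \<subseteq> center UNIV \<and> (\<forall>x. \<tau> (lie_p n x) = 0) \<and>
            (\<forall>a. \<phi> a = h a + \<tau> a))"

text \<open>In the following, \<open>B\<close> is meant to be a subset that is a unital algebra under the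
  operations of the ambient algebra, possibly with a unit other than \<open>1\<close>. Subalgebras are not
  required to contain a unit, but \<open>gen_idem_comm\<close> contains the unit of \<open>B\<close>, since this is an
  idempotent of \<open>B\<close>.\<close>

definition subalgebra_of ::
    "('r::comm_ring_1 \<Rightarrow> 'a::ring_1 \<Rightarrow> 'a) \<Rightarrow> 'a set \<Rightarrow> 'a set \<Rightarrow> bool" where
  "subalgebra_of scale B S \<longleftrightarrow>
     S \<subseteq> B \<and> module.subspace scale S \<and> (\<forall>x\<in>S. \<forall>y\<in>S. x * y \<in> S)"

definition gen_idem_comm ::
    "('r::comm_ring_1 \<Rightarrow> 'a::ring_1 \<Rightarrow> 'a) \<Rightarrow> 'a set \<Rightarrow> 'a set" where
  "gen_idem_comm scale B =
     subalgebra_of scale B hull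
       ({x \<in> B. x * x = x} \<union> {lie_bracket x y | x y. x \<in> B \<and> y \<in> B})"

definition central_ideal ::
    "('r::comm_ring_1 \<Rightarrow> 'a::ring_1 \<Rightarrow> 'a) \<Rightarrow> 'a set \<Rightarrow> 'a set \<Rightarrow> bool" where
  "central_ideal scale B I \<longleftrightarrow>
     module.subspace scale I \<and> (\<forall>b\<in>B. \<forall>x\<in>I. b * x \<in> I \<and> x * b \<in> I) \<and> I \<subseteq> center B"

definition property_P :: "'a::ring set \<Rightarrow> bool" where
  "property_P B \<longleftrightarrow> (\<forall>x\<in>B. lie_bracket x ` B \<subseteq> center B \<longrightarrow> x \<in> center B)"

end

theory Submission
  imports Defs
begin

text \<open>
  Write \<open>\<A>\<close> for the algebra and cut it into its four Peirce corners
  \<open>A = e\<A>e\<close>, \<open>M = e\<A>f\<close>, \<open>N = f\<A>e\<close>, \<open>B = f\<A>f\<close>, and let \<open>Z\<close> be its centre.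
  Elements of \<open>A + B\<close> are called diagonal, those of \<open>M + N\<close> off-diagonal. The map
  \<open>T x = [x, e]\<close> kills \<open>A + B\<close> and is \<open>-1\<close> on \<open>M\<close> and \<open>1\<close> on \<open>N\<close>. So, when the last entries of
  an iterated commutator are set to \<open>e\<close>, the law of a Lie \<open>n\<close>-derivation \<open>\<phi>\<close> becomes a
  statement about short commutators, up to a power of \<open>T\<close>.

  \<^bold>\<open>Normalisation.\<close> Subtracting an inner derivation makes \<open>\<phi> e\<close> diagonal. The law for
  \<open>m, e, \<dots>, e\<close> then contains the summand \<open>[m, \<phi> e]\<close> exactly \<open>n - 1\<close> times, and torsion-freeness
  makes \<open>\<phi> e\<close> commute with \<open>M\<close> and \<open>N\<close>, hence central (\<open>phi_e_central\<close>). From then on every entry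
  \<open>e\<close> contributes nothing to the Leibniz sum, and \<open>\<phi>\<close> is compatible with \<open>T\<close>-images of
  double and triple commutators (\<open>phi_bracket\<close>, \<open>phi_double_bracket\<close>).

  \<^bold>\<open>\<open>\<phi>\<close> respects the corners \<open>M\<close> and \<open>N\<close>.\<close> The component \<open>\<nu> : M \<rightarrow> N\<close> of \<open>\<phi>\<close> vanishes for even
  \<open>n\<close> by a sign. For odd \<open>n\<close> it reverses the module structure, \<open>\<nu>(am) = \<nu>(m)a\<close> and
  \<open>\<nu>(mb) = b\<nu>(m)\<close>. The values \<open>m\<^sub>1\<nu>(m\<^sub>2)\<close> and \<open>\<nu>(m\<^sub>2)m\<^sub>1\<close> then build central ideals of \<open>A\<close> and \<open>B\<close>.
  In one of the two corners these are zero, and the nondegeneracy of \<open>N\<close> against \<open>M\<close> gives \<open>\<nu> = 0\<close>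
  (\<open>twisted_map_zero\<close>).

  \<^bold>\<open>The Lie law modulo \<open>Z\<close>.\<close> The defect \<open>\<phi>[x,y] - [\<phi>x,y] - [x,\<phi>y]\<close> has no component in \<open>M\<close> or
  \<open>N\<close>, since \<open>T\<close> is injective there. The same for triple commutators shows that the defect
  commutes with \<open>M\<close> and \<open>N\<close>, so it is central (\<open>defect_central\<close>).

  \<^bold>\<open>Removing the central part.\<close> An element \<open>a\<close> of \<open>A\<close> is good if \<open>\<phi> a\<close> lies in \<open>A + Z\<close>. The good
  elements form a subalgebra with all idempotents and commutators of \<open>A\<close>; the other
  hypotheses on centres move goodness from \<open>A\<close> to \<open>B\<close> or establish it directly. When all
  elements of \<open>A\<close> and \<open>B\<close> are good, subtracting a linear central-valued map from \<open>\<phi>\<close> leaves a map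
  \<open>h\<close> that preserves all four corners and is a Lie derivation modulo \<open>Z\<close>. Its failure to be
  a derivation is confined to the products \<open>mn\<close> and \<open>nm\<close>, where it generates central
  ideals of \<open>A\<close> and \<open>B\<close>, so it vanishes (\<open>leibniz\<close>). The difference of \<open>\<phi>\<close> and a derivation is
  again a Lie \<open>n\<close>-derivation; being central-valued, it kills all iterated commutators (\<open>standardI\<close>).

  All of this is symmetric in \<open>e\<close> and \<open>f\<close>, and each locale below is shown to be invariant
  under this exchange, so that one half of the cases follows from the other.
\<close>

section \<open>Iterated commutators and their Leibniz sums\<close>

text \<open>The right-hand side of the law of a Lie \<open>n\<close>-derivation. The recursion in \<open>lie_p_sum_Suc\<close> replaces
  the sum over positions by induction on the length of the commutator.\<close>

definition lie_p_sum :: "('a \<Rightarrow> 'a) \<Rightarrow> nat \<Rightarrow> (nat \<Rightarrow> 'a::ring) \<Rightarrow> 'a" where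
  "lie_p_sum \<phi> n x = (\<Sum>i = 1..n. lie_p n (x(i := \<phi> (x i))))"

lemma lie_n_derivation_iff:
  "lie_n_derivation scale n \<phi> \<longleftrightarrow>
     module_hom scale scale \<phi> \<and> (\<forall>x. \<phi> (lie_p n x) = lie_p_sum \<phi> n x)"
  unfolding lie_n_derivation_def lie_p_sum_def ..

lemma lie_p_cong: "(\<And>i. 1 \<le> i \<Longrightarrow> i \<le> n \<Longrightarrow> x i = y i) \<Longrightarrow> lie_p n x = lie_p n y"
  by (induction n x rule: lie_p.induct) auto

lemma lie_bracket_add_left: "lie_bracket (x + y) z = lie_bracket x z + lie_bracket y z"
  and lie_bracket_diff_left: "lie_bracket (x - y) z = lie_bracket x z - lie_bracket y z"
  and lie_bracket_diff_right: "lie_bracket z (x - y) = lie_bracket z x - lie_bracket z y"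
  for x y z :: "'a::ring"
  by (simp_all add: lie_bracket_def algebra_simps)

lemma lie_bracket_zero: "lie_bracket 0 z = 0" "lie_bracket z 0 = 0" for z :: "'a::ring"
  by (simp_all add: lie_bracket_def)

lemma lie_bracket_swap: "lie_bracket x y = - lie_bracket y x" for x y :: "'a::ring"
  by (simp add: lie_bracket_def)

lemma lie_bracket_sum_left:
  "lie_bracket (sum g I) z = (\<Sum>i\<in>I. lie_bracket (g i) z)" for z :: "'a::ring"
  by (simp add: lie_bracket_def sum_distrib_left sum_distrib_right sum_subtractf)

lemma lie_p_sum_1: "lie_p_sum \<phi> (Suc 0) x = \<phi> (x 1)"
  by (simp add: lie_p_sum_def)

lemma lie_p_sum_Suc:
  "lie_p_sum \<phi> (Suc (Suc k)) x =
     lie_bracket (lie_p_sum \<phi> (Suc k) x) (x (Suc (Suc k)))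
     + lie_bracket (lie_p (Suc k) x) (\<phi> (x (Suc (Suc k))))"
proof -
  have "lie_p (Suc k) (x(Suc (Suc k) := y)) = lie_p (Suc k) x" for y
    by (rule lie_p_cong) auto
  moreover have "(\<Sum>i = 1..Suc k. lie_p (Suc (Suc k)) (x(i := \<phi> (x i))))
      = (\<Sum>i = 1..Suc k. lie_bracket (lie_p (Suc k) (x(i := \<phi> (x i)))) (x (Suc (Suc k))))"
    by (rule sum.cong) auto
  moreover have "{1..Suc (Suc k)} = insert (Suc (Suc k)) {1..Suc k}" by auto
  ultimately show ?thesis
    by (simp add: lie_p_sum_def lie_bracket_sum_left del: sum.cl_ivl_Suc)
qed

text \<open>A tail of entries \<open>e\<close> applies \<open>[\<cdot>, e]\<close> repeatedly; if \<open>\<phi> e\<close> commutes with everything, the same is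
  true for the Leibniz sum, since differentiating an entry \<open>e\<close> contributes nothing.\<close>

lemma lie_p_tail:
  assumes "1 \<le> k" and "\<And>i. k < i \<Longrightarrow> x i = e"
  shows "lie_p (k + j) x = ((\<lambda>y. lie_bracket y e) ^^ j) (lie_p k x)"
proof (induction j)
  case (Suc j)
  obtain k' where "k = Suc k'" using assms(1) by (cases k) auto
  with Suc assms(2) show ?case by simp
qed simp

lemma lie_p_sum_tail:
  assumes "1 \<le> k" and "\<And>i. k < i \<Longrightarrow> x i = e" and "\<And>y. lie_bracket y (\<phi> e) = 0"
  shows "lie_p_sum \<phi> (k + j) x = ((\<lambda>y. lie_bracket y e) ^^ j) (lie_p_sum \<phi> k x)"
proof (induction j)
  case (Suc j)
  obtain k' where "k = Suc k'" using assms(1) by (cases k) auto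
  with Suc assms(2,3) show ?case by (simp add: lie_p_sum_Suc)
qed simp

lemma lie_p_sum_diff:
  "lie_p_sum (\<lambda>x. \<phi> x - \<psi> x) n x = lie_p_sum \<phi> n x - lie_p_sum \<psi> n x"
  by (induction n x rule: lie_p.induct)
    (simp_all add: lie_p_sum_1 lie_p_sum_Suc lie_bracket_diff_left lie_bracket_diff_right,
     simp add: lie_p_sum_def)

lemma derivation_lie_p:
  assumes "derivation scale d" and "n \<ge> 1"
  shows "d (lie_p n x) = lie_p_sum d n x"
proof -
  from assms(1) have "module_hom scale scale d" and
    mult: "\<And>x y. d (x * y) = d x * y + x * d y" by (auto simp: derivation_def)
  then have "d (x - y) = d x - d y" for x y by (simp add: module_hom.diff)
  then have br: "d (lie_bracket x y) = lie_bracket (d x) y + lie_bracket x (d y)" for x y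
    by (simp add: lie_bracket_def mult)
  show ?thesis using assms(2)
    by (induction n x rule: lie_p.induct) (simp_all add: lie_p_sum_1 lie_p_sum_Suc br)
qed

text \<open>Every summand is a commutator with one central entry.\<close>

lemma lie_p_sum_central:
  assumes "n \<ge> 2" and "range \<tau> \<subseteq> center UNIV"
  shows "lie_p_sum \<tau> n x = 0"
proof -
  have c: "\<tau> y * z = z * \<tau> y" for y z using assms(2) by (auto simp: center_def)
  have "lie_p_sum \<tau> (Suc (Suc k)) x = 0" for k
    by (induction k) (simp_all add: lie_p_sum_1 lie_p_sum_Suc lie_bracket_def c)
  moreover obtain k where "n = Suc (Suc k)" using assms(1) by (metis add_2_eq_Suc le_Suc_ex)
  ultimately show ?thesis by simp
qed

lemma center_UNIV_closed:
  assumes "z \<in> center UNIV" "w \<in> center UNIV"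
  shows "z + w \<in> center UNIV" "z - w \<in> center UNIV" "- z \<in> center UNIV"
  using assms by (auto simp: center_def algebra_simps)

lemma lie_bracket_center:
  assumes "z \<in> center UNIV"
  shows "lie_bracket z x = 0" "lie_bracket x z = 0"
  using assms by (auto simp: center_def lie_bracket_def)

context unital_algebra
begin

lemma inner_derivation: "derivation scale (\<lambda>x. lie_bracket x t)"
proof -
  have "module_hom scale scale (\<lambda>x. lie_bracket x t)"
    by unfold_locales
      (simp_all add: lie_bracket_def scale_mult_left scale_mult_right algebra_simps)
  then show ?thesis by (simp add: derivation_def lie_bracket_def algebra_simps)
qed

lemma derivation_add:
  assumes "derivation scale g" "derivation scale h"
  shows "derivation scale (\<lambda>x. g x + h x)"
proof -
  interpret g: module_hom scale scale g using assms(1) by (simp add: derivation_def)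
  interpret h: module_hom scale scale h using assms(2) by (simp add: derivation_def)
  have "module_hom scale scale (\<lambda>x. g x + h x)"
    by unfold_locales (simp_all add: g.add h.add g.scale h.scale scale_right_distrib)
  with assms show ?thesis by (simp add: derivation_def algebra_simps)
qed

lemma lie_n_derivation_diff:
  assumes "lie_n_derivation scale n \<phi>" and "derivation scale d" and "n \<ge> 1"
  shows "lie_n_derivation scale n (\<lambda>x. \<phi> x - d x)"
proof -
  interpret p: module_hom scale scale \<phi> using assms(1) by (simp add: lie_n_derivation_def)
  interpret d: module_hom scale scale d using assms(2) by (simp add: derivation_def)
  have "module_hom scale scale (\<lambda>x. \<phi> x - d x)"
    by unfold_locales (simp_all add: p.add d.add p.scale d.scale scale_right_diff_distrib)
  moreover have "\<phi> (lie_p n x) - d (lie_p n x) = lie_p_sum (\<lambda>x. \<phi> x - d x) n x" for x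
    using assms(1) derivation_lie_p[OF assms(2,3)] by (simp add: lie_n_derivation_iff lie_p_sum_diff)
  ultimately show ?thesis by (simp add: lie_n_derivation_iff)
qed

text \<open>The difference \<open>\<tau> = \<phi> - h\<close> is itself a Lie \<open>n\<close>-derivation, so its value at an iterated commutator is a
  sum of commutators with a central entry; this is why \<open>\<tau>\<close> vanishes there.\<close>

lemma standardI:
  assumes "lie_n_derivation scale n \<phi>" and "n \<ge> 2" and "derivation scale h"
    and "range (\<lambda>x. \<phi> x - h x) \<subseteq> center UNIV"
  shows "standard scale n \<phi>"
proof -
  have \<tau>: "lie_n_derivation scale n (\<lambda>x. \<phi> x - h x)"
    using assms by (intro lie_n_derivation_diff) simp_all
  then have "\<phi> (lie_p n x) - h (lie_p n x) = 0" for x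
    using lie_p_sum_central[OF assms(2,4)] by (simp add: lie_n_derivation_iff)
  with \<tau> assms(3,4) show ?thesis
    unfolding standard_def lie_n_derivation_iff
    by (intro exI[of _ h] exI[of _ "\<lambda>x. \<phi> x - h x"]) simp
qed

end

section \<open>The Peirce decomposition\<close>

text \<open>One-sided Peirce membership. The predicates stay folded: side conditions such as
  \<open>absorbs_right e x\<close> are decided by the shape of \<open>x\<close>, so products across different corners
  are rewritten to \<open>0\<close> without a search through equations \<open>x * e = x\<close>.\<close>

definition absorbs_left :: "'a::ring \<Rightarrow> 'a \<Rightarrow> bool" where
  "absorbs_left p x \<longleftrightarrow> p * x = x"

definition absorbs_right :: "'a::ring \<Rightarrow> 'a \<Rightarrow> bool" where
  "absorbs_right p x \<longleftrightarrow> x * p = x"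

lemma absorbs_left_closed:
  "absorbs_left p x \<Longrightarrow> absorbs_left p (x * y)"
  "absorbs_left p x \<Longrightarrow> absorbs_left p y \<Longrightarrow> absorbs_left p (x + y)"
  "absorbs_left p x \<Longrightarrow> absorbs_left p y \<Longrightarrow> absorbs_left p (x - y)"
  "absorbs_left p x \<Longrightarrow> absorbs_left p (- x)"
  "absorbs_left p 0"
  for p x y :: "'a::ring"
  by (simp_all add: absorbs_left_def algebra_simps flip: mult.assoc)

lemma absorbs_right_closed:
  "absorbs_right p y \<Longrightarrow> absorbs_right p (x * y)"
  "absorbs_right p x \<Longrightarrow> absorbs_right p y \<Longrightarrow> absorbs_right p (x + y)"
  "absorbs_right p x \<Longrightarrow> absorbs_right p y \<Longrightarrow> absorbs_right p (x - y)"
  "absorbs_right p x \<Longrightarrow> absorbs_right p (- x)"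
  "absorbs_right p 0"
  for p x y :: "'a::ring"
  by (simp_all add: absorbs_right_def algebra_simps)

locale peirce = unital_algebra scale
  for scale :: "'r::comm_ring_1 \<Rightarrow> 'a::ring_1 \<Rightarrow> 'a" +
  fixes e f :: 'a
  assumes ee: "e * e = e" and ff: "f * f = f" and ef: "e * f = 0" and fe: "f * e = 0"
    and e_plus_f: "e + f = 1"
begin

lemma swap_peirce: "peirce scale f e"
  by unfold_locales (use ee ff ef fe e_plus_f in \<open>simp_all add: add.commute\<close>)

lemma absorbs_simps:
  "absorbs_left e e" "absorbs_left f f" "absorbs_right e e" "absorbs_right f f"
  "absorbs_left e x \<Longrightarrow> e * x = x" "absorbs_left f x \<Longrightarrow> f * x = x"
  "absorbs_right e x \<Longrightarrow> x * e = x" "absorbs_right f x \<Longrightarrow> x * f = x"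
  "absorbs_right e x \<Longrightarrow> x * (e * y) = x * y" "absorbs_right f x \<Longrightarrow> x * (f * y) = x * y"
  "absorbs_right e x \<Longrightarrow> absorbs_left f y \<Longrightarrow> x * y = 0"
  "absorbs_right f x \<Longrightarrow> absorbs_left e y \<Longrightarrow> x * y = 0"
proof -
  show "absorbs_right e x \<Longrightarrow> absorbs_left f y \<Longrightarrow> x * y = 0"
    by (metis absorbs_left_def absorbs_right_def ef mult.assoc mult_zero_left mult_zero_right)
  show "absorbs_right f x \<Longrightarrow> absorbs_left e y \<Longrightarrow> x * y = 0"
    by (metis absorbs_left_def absorbs_right_def fe mult.assoc mult_zero_left mult_zero_right)
qed (simp_all add: absorbs_left_def absorbs_right_def ee ff flip: mult.assoc)

lemma in_corner_iff:
  "x \<in> corner e e \<longleftrightarrow> absorbs_left e x \<and> absorbs_right e x"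
  "x \<in> corner e f \<longleftrightarrow> absorbs_left e x \<and> absorbs_right f x"
  "x \<in> corner f e \<longleftrightarrow> absorbs_left f x \<and> absorbs_right e x"
  "x \<in> corner f f \<longleftrightarrow> absorbs_left f x \<and> absorbs_right f x"
  unfolding corner_def absorbs_left_def absorbs_right_def
  using ee ff by auto (metis mult.assoc)+

lemmas peirce_simps = in_corner_iff absorbs_left_closed absorbs_right_closed absorbs_simps
  ee ff ef fe lie_bracket_def mult.assoc distrib_left distrib_right left_diff_distrib
  right_diff_distrib

lemma peirce_sum: "x = e * x * e + e * x * f + f * x * e + f * x * f"
proof -
  have "x = (e + f) * x * (e + f)" by (simp add: e_plus_f)
  then show ?thesis by (simp only: distrib_left distrib_right ac_simps)
qed

lemma corner_component:
  "e * x * e \<in> corner e e" "e * x * f \<in> corner e f" "f * x * e \<in> corner f e" "f * x * f \<in> corner f f"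
  by (auto simp: corner_def)

lemma commute_of_diagonal:
  assumes "e * c * f = 0" "f * c * e = 0"
  shows "e * c = c * e" and "f * c = c * f"
proof -
  have f: "f = 1 - e" using e_plus_f by (simp add: algebra_simps)
  have "e * c = e * c * (e + f)" "c * e = (e + f) * c * e"
    by (simp_all add: e_plus_f)
  then have "e * c = e * c * e" "c * e = e * c * e"
    unfolding distrib_left distrib_right using assms(1,2) by simp_all
  then show "e * c = c * e" by simp
  then show "f * c = c * f" unfolding f left_diff_distrib right_diff_distrib by simp
qed

lemma bracket_diagonal_corner:
  assumes "e * c * f = 0" "f * c * e = 0" and m: "m \<in> corner e f"
  shows "lie_bracket m c \<in> corner e f"
proof -
  note comm = commute_of_diagonal[OF assms(1,2)]
  have "e * (c * m) = c * (e * m)" "m * c * f = m * f * c"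
    by (metis comm(1) mult.assoc) (metis comm(2) mult.assoc)
  then have "e * (c * m) = c * m" "m * c * f = m * c" using m by (simp_all add: in_corner_iff absorbs_simps)
  moreover have "e * (m * c) = m * c" "c * m * f = c * m" using m by (simp_all add: peirce_simps)
  ultimately show ?thesis
    by (simp add: in_corner_iff absorbs_left_def absorbs_right_def lie_bracket_def
        left_diff_distrib right_diff_distrib)
qed

lemma corner_mult: "x \<in> corner e e \<Longrightarrow> y \<in> corner e e \<Longrightarrow> x * y \<in> corner e e"
  by (simp add: peirce_simps)

lemma corner_diff: "x \<in> corner e e \<Longrightarrow> y \<in> corner e e \<Longrightarrow> x - y \<in> corner e e"
  by (simp add: peirce_simps)

text \<open>The map \<open>[\<cdot>, e]\<close> acts on the four corners by \<open>0, -1, 1, 0\<close>.\<close>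

lemma bracket_e_funpow:
  "e * ((\<lambda>x. lie_bracket x e) ^^ k) y * f = (- 1) ^ k * (e * y * f)"
  "f * ((\<lambda>x. lie_bracket x e) ^^ k) y * e = f * y * e"
  "k > 0 \<Longrightarrow> e * ((\<lambda>x. lie_bracket x e) ^^ k) y * e = 0"
  "k > 0 \<Longrightarrow> f * ((\<lambda>x. lie_bracket x e) ^^ k) y * f = 0"
proof -
  have s: "e * lie_bracket x e * f = - (e * x * f)" "f * lie_bracket x e * e = f * x * e"
    "e * lie_bracket x e * e = 0" "f * lie_bracket x e * f = 0" for x
    by (simp_all add: peirce_simps)
  show "e * ((\<lambda>x. lie_bracket x e) ^^ k) y * f = (- 1) ^ k * (e * y * f)"
    by (induction k) (simp_all add: s)
  show "f * ((\<lambda>x. lie_bracket x e) ^^ k) y * e = f * y * e"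
    by (induction k) (simp_all add: s)
  show "k > 0 \<Longrightarrow> e * ((\<lambda>x. lie_bracket x e) ^^ k) y * e = 0"
    "k > 0 \<Longrightarrow> f * ((\<lambda>x. lie_bracket x e) ^^ k) y * f = 0"
    by (cases k; simp add: s)+
qed

text \<open>The ideal is \<open>eAe u\<close>; its elements are central by assumption, so it is two-sided.\<close>

lemma central_ideal_generated:
  assumes no_ideal: "\<And>I. central_ideal scale (corner e e) I \<Longrightarrow> I = {0}"
    and u: "u \<in> corner e e"
    and central: "\<And>a. a \<in> corner e e \<Longrightarrow> a * u \<in> center (corner e e)"
  shows "u = 0"
proof -
  let ?I = "(\<lambda>a. a * u) ` corner e e"
  have "central_ideal scale (corner e e) ?I"
    unfolding central_ideal_def
  proof (intro conjI ballI)
    show "subspace ?I"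
    proof (rule subspaceI)
      show "0 \<in> ?I" by (rule image_eqI[of _ _ 0]) (simp_all add: peirce_simps)
      fix x y assume "x \<in> ?I" "y \<in> ?I"
      then obtain a b where "x = a * u" "y = b * u" "a \<in> corner e e" "b \<in> corner e e" by auto
      then show "x + y \<in> ?I" by (intro image_eqI[of _ _ "a + b"]) (simp_all add: peirce_simps)
    next
      fix c x assume "x \<in> ?I"
      then obtain a where "x = a * u" and a: "a \<in> corner e e" by auto
      moreover have "scale c a \<in> corner e e"
        using a unfolding in_corner_iff
        by (simp add: absorbs_left_def absorbs_right_def scale_mult_left scale_mult_right)
      ultimately show "scale c x \<in> ?I"
        by (intro image_eqI[of _ _ "scale c a"]) (simp_all add: scale_mult_left)
    qed
    show "?I \<subseteq> center (corner e e)" using central by auto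
    fix b x assume b: "b \<in> corner e e" and "x \<in> ?I"
    then obtain a where x: "x = a * u" and a: "a \<in> corner e e" by auto
    show "b * x \<in> ?I"
      by (rule image_eqI[of _ _ "b * a"]) (use a b x in \<open>simp_all add: peirce_simps\<close>)
    then show "x * b \<in> ?I" using central[OF a] b x by (simp add: center_def)
  qed
  then have "?I = {0}" by (rule no_ideal)
  moreover have "e * u \<in> ?I" by (rule imageI) (simp add: peirce_simps)
  ultimately have "e * u = 0" by simp
  then show ?thesis using u by (simp add: peirce_simps)
qed

end

text \<open>Each diagonal corner acts faithfully on the two off-diagonal corners taken together. Hence
  identities in a diagonal corner, and centrality, may be tested on \<open>eAf\<close> and \<open>fAe\<close>.\<close>

locale faithful_peirce = peirce scale e f
  for scale :: "'r::comm_ring_1 \<Rightarrow> 'a::ring_1 \<Rightarrow> 'a" and e f :: 'a +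
  assumes faithful_e: "a \<in> corner e e \<Longrightarrow> (\<And>m. m \<in> corner e f \<Longrightarrow> a * m = 0) \<Longrightarrow>
      (\<And>n. n \<in> corner f e \<Longrightarrow> n * a = 0) \<Longrightarrow> a = 0"
    and faithful_f: "b \<in> corner f f \<Longrightarrow> (\<And>n. n \<in> corner f e \<Longrightarrow> b * n = 0) \<Longrightarrow>
      (\<And>m. m \<in> corner e f \<Longrightarrow> m * b = 0) \<Longrightarrow> b = 0"
begin

lemma swap_faithful: "faithful_peirce scale f e"
proof -
  interpret s: peirce scale f e by (rule swap_peirce)
  show ?thesis by unfold_locales (fact faithful_f faithful_e)+
qed

text \<open>Both \<open>ac\<close> and \<open>ca\<close> act in the same way on \<open>eAf\<close> and \<open>fAe\<close>, because \<open>c\<close> may be moved past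
  elements of these corners.\<close>

lemma diagonal_commutator_zero:
  assumes a: "a \<in> corner e e" and c: "e * c = c * e"
    and M: "\<And>m. m \<in> corner e f \<Longrightarrow> c * m = m * c" and N: "\<And>n. n \<in> corner f e \<Longrightarrow> c * n = n * c"
  shows "a * c = c * a"
proof -
  have "a * c - c * a = 0"
  proof (rule faithful_e)
    have "absorbs_right e (a * c)"
      unfolding absorbs_right_def using a c
      by (metis in_corner_iff(1) absorbs_right_def mult.assoc)
    moreover have "absorbs_left e (c * a)"
      unfolding absorbs_left_def using a c
      by (metis in_corner_iff(1) absorbs_left_def mult.assoc)
    ultimately have "a * c \<in> corner e e" "c * a \<in> corner e e"
      using a by (simp_all add: peirce_simps)
    then show "a * c - c * a \<in> corner e e" by (simp add: peirce_simps)
    show "(a * c - c * a) * m = 0" if m: "m \<in> corner e f" for m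
    proof -
      have "a * m \<in> corner e f" using a m by (simp add: peirce_simps)
      have "(a * c - c * a) * m = a * (c * m) - c * (a * m)" by (simp add: algebra_simps)
      also have "\<dots> = 0" unfolding M[OF m] M[OF \<open>a * m \<in> corner e f\<close>] by (simp add: mult.assoc)
      finally show ?thesis .
    qed
    show "n * (a * c - c * a) = 0" if n: "n \<in> corner f e" for n
    proof -
      have "n * a \<in> corner f e" using a n by (simp add: peirce_simps)
      have "n * (a * c - c * a) = (n * a) * c - (n * c) * a" by (simp add: algebra_simps)
      also have "\<dots> = 0"
        unfolding N[OF n, symmetric] N[OF \<open>n * a \<in> corner f e\<close>, symmetric] by (simp add: mult.assoc)
      finally show ?thesis .
    qed
  qed
  then show ?thesis by simp
qed

lemma diagonal_centralI:
  assumes "e * c * f = 0" "f * c * e = 0"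
    and M: "\<And>m. m \<in> corner e f \<Longrightarrow> c * m = m * c" and N: "\<And>n. n \<in> corner f e \<Longrightarrow> c * n = n * c"
  shows "c \<in> center UNIV"
proof -
  interpret s: faithful_peirce scale f e by (rule swap_faithful)
  note comm = commute_of_diagonal[OF assms(1,2)]
  have "c * x = x * c" for x
  proof -
    have 1: "e * x * e * c = c * (e * x * e)"
      by (rule diagonal_commutator_zero[OF corner_component(1) comm(1) M N])
    have 2: "f * x * f * c = c * (f * x * f)"
      by (rule s.diagonal_commutator_zero[OF corner_component(4) comm(2) N M])
    have "c * (e * x * e + e * x * f + f * x * e + f * x * f)
        = (e * x * e + e * x * f + f * x * e + f * x * f) * c"
      unfolding distrib_left distrib_right 1 2 M[OF corner_component(2)] N[OF corner_component(3)] ..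
    then show ?thesis unfolding peirce_sum[of x, symmetric] .
  qed
  then show ?thesis by (simp add: center_def)
qed

text \<open>A central element is determined by its component at \<open>f\<close>. This makes the choice of central
  elements in \<open>central_lift\<close> unique, hence linear.\<close>

lemma central_zero:
  assumes "z \<in> center UNIV" "f * z = 0"
  shows "z = 0"
proof -
  have z: "z * x = x * z" for x using assms(1) by (auto simp: center_def)
  have f: "f = 1 - e" using e_plus_f by (simp add: algebra_simps)
  have e: "e * z = z" using assms(2) unfolding f left_diff_distrib by simp
  show ?thesis
  proof (rule faithful_e)
    show "z \<in> corner e e" using e z[of e] by (simp add: in_corner_iff absorbs_left_def absorbs_right_def)
    show "z * m = 0" if "m \<in> corner e f" for m
    proof -
      have "z * m = m * (f * z)" using that by (simp add: z peirce_simps)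
      then show ?thesis by (simp add: assms(2))
    qed
    show "n * z = 0" if "n \<in> corner f e" for n
    proof -
      have "n * z = z * (f * n)" using that by (simp add: z peirce_simps)
      also have "\<dots> = (f * z) * n" by (simp add: z mult.assoc)
      finally show ?thesis by (simp add: assms(2))
    qed
  qed
qed

lemma central_lift:
  assumes g: "module_hom scale scale g"
    and lift: "\<And>x. \<exists>z\<in>center UNIV. f * z = g x"
  shows "\<exists>\<theta>. module_hom scale scale \<theta> \<and> range \<theta> \<subseteq> center UNIV \<and> (\<forall>x. f * \<theta> x = g x)"
proof -
  interpret g: module_hom scale scale g by (rule g)
  from lift obtain \<theta> where \<theta>: "\<And>x. \<theta> x \<in> center UNIV" and f\<theta>: "\<And>x. f * \<theta> x = g x" by metis
  have comm: "\<theta> x * y = y * \<theta> x" for x y using \<theta> by (auto simp: center_def)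
  have "module_hom scale scale \<theta>"
  proof (unfold_locales)
    fix x y r
    have "\<theta> (x + y) - (\<theta> x + \<theta> y) = 0"
      by (rule central_zero) (simp_all add: center_def comm f\<theta> g.add algebra_simps)
    then show "\<theta> (x + y) = \<theta> x + \<theta> y" by simp
    have "\<theta> (scale r x) - scale r (\<theta> x) = 0"
      by (rule central_zero)
        (simp_all add: center_def comm f\<theta> g.scale algebra_simps scale_mult_left scale_mult_right)
    then show "\<theta> (scale r x) = scale r (\<theta> x)" by simp
  qed
  with \<theta> f\<theta> show ?thesis by blast
qed

end

section \<open>Order-reversing maps between the off-diagonal corners\<close>

lemma torsion_free_2D: "torsion_free 2 TYPE('a::ring_1) \<Longrightarrow> x + x = 0 \<Longrightarrow> (x::'a) = 0"
  unfolding torsion_free_def by (metis mult_2 of_nat_numeral)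

context peirce
begin

text \<open>The idea behind both cases of the vanishing theorem below. The symmetrised form
  \<open>u(s,t) = Y s t + Y t s\<close> has central values, and applying this to \<open>u(as,t) + u(s,at) = 2au(s,t)\<close>
  shows that they generate central ideals; so \<open>Y\<close> is alternating. An alternating form with these
  module properties satisfies \<open>a Y s t = Y s t a\<close> and \<open>a Y s t = Y (as) t\<close>, so its values generate
  central ideals as well.\<close>

lemma alternating_form_zero:
  assumes no_ideal: "\<And>I. central_ideal scale (corner e e) I \<Longrightarrow> I = {0}"
    and tf2: "torsion_free 2 TYPE('a)"
    and Y: "\<And>s t. s \<in> S \<Longrightarrow> t \<in> S \<Longrightarrow> Y s t \<in> corner e e"
    and act: "\<And>a s. a \<in> corner e e \<Longrightarrow> s \<in> S \<Longrightarrow> act a s \<in> S"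
    and left: "\<And>a s t. a \<in> corner e e \<Longrightarrow> s \<in> S \<Longrightarrow> t \<in> S \<Longrightarrow> Y (act a s) t = a * Y s t"
    and right: "\<And>a s t. a \<in> corner e e \<Longrightarrow> s \<in> S \<Longrightarrow> t \<in> S \<Longrightarrow> Y s (act a t) = Y s t * a"
    and comm: "\<And>a s t. a \<in> corner e e \<Longrightarrow> s \<in> S \<Longrightarrow> t \<in> S \<Longrightarrow>
      a * (Y s t + Y t s) = (Y s t + Y t s) * a"
    and st: "s \<in> S" "t \<in> S"
  shows "Y s t = 0"
proof -
  have sym_zero: "Y s t + Y t s = 0" if s: "s \<in> S" and t: "t \<in> S" for s t
  proof (rule central_ideal_generated[OF no_ideal])
    let ?u = "Y s t + Y t s"
    show u: "?u \<in> corner e e" using Y[OF s t] Y[OF t s] by (simp add: peirce_simps)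
    fix a assume a: "a \<in> corner e e"
    have au: "a * ?u \<in> corner e e" using a u by (rule corner_mult)
    have "a * ?u * b = b * (a * ?u)" if b: "b \<in> corner e e" for b
    proof -
      have "a * Y s t + Y t s * a + (Y s t * a + a * Y t s) = a * ?u + ?u * a"
        by (simp add: algebra_simps)
      also have "\<dots> = a * ?u + a * ?u" by (simp only: comm[OF a s t])
      finally have eq: "a * Y s t + Y t s * a + (Y s t * a + a * Y t s) = a * ?u + a * ?u" .
      have "b * (a * ?u + a * ?u) = (a * ?u + a * ?u) * b"
        using comm[OF b act[OF a s] t] comm[OF b s act[OF a t]]
        unfolding eq[symmetric] left[OF a s t] right[OF a t s] right[OF a s t] left[OF a t s]
        by (simp only: distrib_left[of b "a * Y s t + Y t s * a"] distrib_right[of "a * Y s t + Y t s * a"])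
      then have "(a * ?u * b - b * (a * ?u)) + (a * ?u * b - b * (a * ?u)) = 0"
        by (simp only: distrib_left distrib_right) (simp add: algebra_simps)
      then show ?thesis using torsion_free_2D[OF tf2] by (metis right_minus_eq)
    qed
    with au show "a * ?u \<in> center (corner e e)" by (simp add: center_def)
  qed
  have Y_comm: "a * Y s t = Y s t * a" if a: "a \<in> corner e e" and s: "s \<in> S" and t: "t \<in> S" for a s t
  proof -
    have "a * Y s t + Y t s * a = 0"
      using sym_zero[OF act[OF a s] t] by (simp only: left[OF a s t] right[OF a t s])
    moreover have "Y t s = - Y s t" using sym_zero[OF s t] by (simp add: eq_neg_iff_add_eq_0 add.commute)
    ultimately show ?thesis by simp
  qed
  show ?thesis
  proof (rule central_ideal_generated[OF no_ideal])
    show "Y s t \<in> corner e e" using Y st .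
    fix a assume a: "a \<in> corner e e"
    show "a * Y s t \<in> center (corner e e)"
      using Y[OF act[OF a st(1)] st(2)] Y_comm[OF _ act[OF a st(1)] st(2)]
      unfolding left[OF a st] center_def by auto
  qed
qed

end

context faithful_peirce
begin

text \<open>An order-reversing module map \<open>\<nu> : M \<rightarrow> N\<close>. The forms \<open>m\<^sub>1 \<nu>(m\<^sub>2)\<close> and \<open>\<nu>(m\<^sub>2) m\<^sub>1\<close> fit the preceding
  lemma in \<open>eAe\<close> and in \<open>fAf\<close>. If one of them vanishes, then \<open>anti\<close> and
  faithfulness kill the other, and then \<open>\<nu> m\<close> is annihilated by \<open>M\<close> from both sides.\<close>

lemma twisted_map_zero:
  fixes \<nu> :: "'a \<Rightarrow> 'a"
  assumes no_ideal: "(\<forall>I. central_ideal scale (corner e e) I \<longrightarrow> I = {0}) \<or>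
      (\<forall>I. central_ideal scale (corner f f) I \<longrightarrow> I = {0})"
    and tf2: "torsion_free 2 TYPE('a)"
    and N_zero: "\<And>n. n \<in> corner f e \<Longrightarrow> (\<And>m. m \<in> corner e f \<Longrightarrow> m * n = 0) \<Longrightarrow>
      (\<And>m. m \<in> corner e f \<Longrightarrow> n * m = 0) \<Longrightarrow> n = 0"
    and \<nu>: "\<And>m. m \<in> corner e f \<Longrightarrow> \<nu> m \<in> corner f e"
    and \<nu>_left: "\<And>a m. a \<in> corner e e \<Longrightarrow> m \<in> corner e f \<Longrightarrow> \<nu> (a * m) = \<nu> m * a"
    and \<nu>_right: "\<And>m b. m \<in> corner e f \<Longrightarrow> b \<in> corner f f \<Longrightarrow> \<nu> (m * b) = b * \<nu> m"
    and skew: "\<And>m1 m2 m3. m1 \<in> corner e f \<Longrightarrow> m2 \<in> corner e f \<Longrightarrow> m3 \<in> corner e f \<Longrightarrow>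
      (m1 * \<nu> m2 - m2 * \<nu> m1) * m3 = m3 * (\<nu> m1 * m2 - \<nu> m2 * m1)"
    and anti: "\<And>m1 m2 n. m1 \<in> corner e f \<Longrightarrow> m2 \<in> corner e f \<Longrightarrow> n \<in> corner f e \<Longrightarrow>
      \<nu> m2 * m1 * n = - (n * m1 * \<nu> m2)"
    and m: "m \<in> corner e f"
  shows "\<nu> m = 0"
proof -
  interpret s: faithful_peirce scale f e by (rule swap_faithful)
  let ?M = "corner e f" and ?N = "corner f e" and ?A = "corner e e" and ?B = "corner f f"
  \<comment> \<open>Two readings of \<open>\<nu> (m1 * n * m2)\<close>, with \<open>m1 * n\<close> in \<open>eAe\<close> or \<open>n * m2\<close> in \<open>fAf\<close>.\<close>
  have cross: "\<nu> m2 * m1 * n = n * m2 * \<nu> m1" if "m1 \<in> ?M" "m2 \<in> ?M" "n \<in> ?N" for m1 m2 n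
  proof -
    have "\<nu> (m1 * n * m2) = \<nu> m2 * (m1 * n)" by (rule \<nu>_left) (use that in \<open>simp_all add: peirce_simps\<close>)
    moreover have "\<nu> (m1 * (n * m2)) = n * m2 * \<nu> m1" by (rule \<nu>_right) (use that in \<open>simp_all add: peirce_simps\<close>)
    ultimately show ?thesis by (simp add: mult.assoc)
  qed
  have N_sym: "n * (m1 * \<nu> m2 + m2 * \<nu> m1) = 0" if "m1 \<in> ?M" "m2 \<in> ?M" "n \<in> ?N" for m1 m2 n
    using cross[OF that] anti[OF that] by (simp add: distrib_left mult.assoc)
  have sym_N: "(\<nu> m1 * m2 + \<nu> m2 * m1) * n = 0" if "m1 \<in> ?M" "m2 \<in> ?M" "n \<in> ?N" for m1 m2 n
    using cross[OF that(2,1,3)] anti[OF that] by (simp add: distrib_right mult.assoc)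
  have \<nu>M: "m1 * \<nu> m2 \<in> ?A" "\<nu> m2 * m1 \<in> ?B" if "m1 \<in> ?M" "m2 \<in> ?M" for m1 m2
    using that \<nu>[OF that(1)] \<nu>[OF that(2)] by (simp_all add: peirce_simps)
  have "m1 * \<nu> m2 = 0 \<and> \<nu> m2 * m1 = 0" if m1: "m1 \<in> ?M" and m2: "m2 \<in> ?M" for m1 m2
    using no_ideal
  proof
    assume no_ideal_e: "\<forall>I. central_ideal scale ?A I \<longrightarrow> I = {0}"
    have Y0: "m1 * \<nu> m2 = 0" if "m1 \<in> ?M" "m2 \<in> ?M" for m1 m2
    proof (rule alternating_form_zero[where S = ?M and Y = "\<lambda>m1 m2. m1 * \<nu> m2" and act = "(*)"])
      show "central_ideal scale ?A I \<Longrightarrow> I = {0}" for I using no_ideal_e by blast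
      show "s * \<nu> t \<in> ?A" if "s \<in> ?M" "t \<in> ?M" for s t using that by (rule \<nu>M(1))
      show act: "a * s \<in> ?M" if "a \<in> ?A" "s \<in> ?M" for a s using that by (simp add: peirce_simps)
      show "a * s * \<nu> t = a * (s * \<nu> t)" for a s t by (simp add: mult.assoc)
      show "s * \<nu> (a * t) = s * \<nu> t * a" if "a \<in> ?A" "t \<in> ?M" for a s t
        using that by (simp add: \<nu>_left mult.assoc)
      fix a s t assume a: "a \<in> ?A" and s: "s \<in> ?M" and t: "t \<in> ?M"
      let ?u = "s * \<nu> t + t * \<nu> s"
      have u: "?u \<in> ?A" using \<nu>M[OF s t] \<nu>M[OF t s] by (simp add: peirce_simps)
      have "a * ?u - ?u * a = 0"
      proof (rule faithful_e)
        show "a * ?u - ?u * a \<in> ?A"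
          using a u by (intro corner_diff corner_mult)
        fix m assume m: "m \<in> ?M"
        \<comment> \<open>\<open>skew\<close> for \<open>(as, t)\<close> and for \<open>(s, at)\<close> have the same right-hand side, because
          \<open>\<nu> (as) t = \<nu>(s) at\<close>.\<close>
        have "(a * ?u - ?u * a) * m
            = (a * s * \<nu> t - t * \<nu> (a * s)) * m - (s * \<nu> (a * t) - a * t * \<nu> s) * m"
          by (simp add: \<nu>_left[OF a s] \<nu>_left[OF a t] algebra_simps)
        also have "\<dots> = 0"
          unfolding skew[OF act[OF a s] t m] skew[OF s act[OF a t] m]
          unfolding \<nu>_left[OF a s] \<nu>_left[OF a t]
          by (simp add: algebra_simps)
        finally show "(a * ?u - ?u * a) * m = 0" .
      next
        fix n assume n: "n \<in> ?N"
        have na: "n * a \<in> ?N" using n a by (simp add: peirce_simps)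
        have "n * (a * ?u - ?u * a) = n * a * ?u - n * ?u * a" by (simp add: algebra_simps)
        then show "n * (a * ?u - ?u * a) = 0"
          by (simp only: N_sym[OF s t na] N_sym[OF s t n]) simp
      qed
      then show "a * ?u = ?u * a" by simp
    qed (use that tf2 in auto)
    have "\<nu> m2 * m1 = 0"
    proof (rule faithful_f)
      show "\<nu> m2 * m1 \<in> ?B" using m1 m2 by (rule \<nu>M(2))
      show "\<nu> m2 * m1 * n = 0" if "n \<in> ?N" for n
        using anti[OF m1 m2 that] Y0[OF m1 m2] by (simp add: mult.assoc)
      show "m * (\<nu> m2 * m1) = 0" if "m \<in> ?M" for m
        using Y0[OF that m2] by (simp flip: mult.assoc)
    qed
    with Y0[OF m1 m2] show ?thesis by simp
  next
    assume no_ideal_f: "\<forall>I. central_ideal scale ?B I \<longrightarrow> I = {0}"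
    have Z0: "\<nu> m2 * m1 = 0" if "m1 \<in> ?M" "m2 \<in> ?M" for m1 m2
    proof (rule s.alternating_form_zero[where S = ?M and Y = "\<lambda>m2 m1. \<nu> m2 * m1" and act = "\<lambda>b m. m * b"])
      show "central_ideal scale ?B I \<Longrightarrow> I = {0}" for I using no_ideal_f by blast
      show "\<nu> t * s \<in> ?B" if "t \<in> ?M" "s \<in> ?M" for s t using that(2,1) by (rule \<nu>M(2))
      show act: "s * b \<in> ?M" if "b \<in> ?B" "s \<in> ?M" for b s using that by (simp add: peirce_simps)
      show "\<nu> (t * b) * s = b * (\<nu> t * s)" if "b \<in> ?B" "t \<in> ?M" for b s t
        using that by (simp add: \<nu>_right mult.assoc)
      show "\<nu> t * (s * b) = \<nu> t * s * b" for b s t by (simp add: mult.assoc)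
      fix b s t assume b: "b \<in> ?B" and s: "s \<in> ?M" and t: "t \<in> ?M"
      let ?w = "\<nu> s * t + \<nu> t * s"
      have w: "?w \<in> ?B" using \<nu>M[OF s t] \<nu>M[OF t s] by (simp add: peirce_simps)
      have "b * ?w - ?w * b = 0"
      proof (rule faithful_f)
        show "b * ?w - ?w * b \<in> ?B"
          using b w by (intro s.corner_diff s.corner_mult)
        fix m assume m: "m \<in> ?M"
        \<comment> \<open>\<open>skew\<close> for \<open>(sb, t)\<close> and for \<open>(s, tb)\<close> have the same left-hand side, because
          \<open>sb \<nu>(t) = s \<nu> (tb)\<close>.\<close>
        have "m * (b * ?w - ?w * b)
            = m * (\<nu> (s * b) * t - \<nu> t * (s * b)) - m * (\<nu> s * (t * b) - \<nu> (t * b) * s)"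
          by (simp add: \<nu>_right[OF s b] \<nu>_right[OF t b] algebra_simps)
        also have "\<dots> = 0"
          unfolding skew[OF act[OF b s] t m, symmetric] skew[OF s act[OF b t] m, symmetric]
          unfolding \<nu>_right[OF s b] \<nu>_right[OF t b]
          by (simp add: algebra_simps)
        finally show "m * (b * ?w - ?w * b) = 0" .
      next
        fix n assume n: "n \<in> ?N"
        have bn: "b * n \<in> ?N" using n b by (simp add: peirce_simps)
        have "(b * ?w - ?w * b) * n = b * (?w * n) - ?w * (b * n)" by (simp add: algebra_simps)
        then show "(b * ?w - ?w * b) * n = 0"
          by (simp only: sym_N[OF s t bn] sym_N[OF s t n]) simp
      qed
      then show "b * ?w = ?w * b" by simp
    qed (use that tf2 in auto)
    have "m1 * \<nu> m2 = 0"
    proof (rule faithful_e)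
      show "m1 * \<nu> m2 \<in> ?A" using m1 m2 by (rule \<nu>M(1))
      show "m1 * \<nu> m2 * m = 0" if "m \<in> ?M" for m
        using Z0[OF that m2] by (simp add: mult.assoc)
      show "n * (m1 * \<nu> m2) = 0" if "n \<in> ?N" for n
        using anti[OF m1 m2 that] Z0[OF m1 m2] by (simp add: mult.assoc)
    qed
    with Z0[OF m1 m2] show ?thesis by simp
  qed
  then show ?thesis using N_zero[OF \<nu>[OF m]] m by blast
qed

lemma central_in_off_diagonal:
  assumes "z \<in> center UNIV" "z \<in> corner e f \<or> z \<in> corner f e"
  shows "z = 0"
proof -
  have "e * z = z * e" "f * z = z * f" using assms(1) by (auto simp: center_def)
  then show ?thesis using assms(2) by (auto simp: peirce_simps)
qed

lemma central_component:
  assumes "z \<in> center UNIV"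
  shows "e * z * e \<in> center (corner e e)"
proof -
  have "z * x = x * z" for x using assms by (auto simp: center_def)
  then have "e * z * e * a = a * (e * z * e)" if "a \<in> corner e e" for a
    using that by (simp add: peirce_simps)
  then show ?thesis by (simp add: center_def corner_component)
qed

end

section \<open>Graded Lie derivations modulo the centre\<close>

text \<open>The situation after the central part of a Lie \<open>n\<close>-derivation is removed.\<close>

locale graded_lie_mod_center = faithful_peirce scale e f
  for scale :: "'r::comm_ring_1 \<Rightarrow> 'a::ring_1 \<Rightarrow> 'a" and e f :: 'a +
  fixes h :: "'a \<Rightarrow> 'a"
  assumes h_add: "h (x + y) = h x + h y"
    and h_ee: "x \<in> corner e e \<Longrightarrow> h x \<in> corner e e"
    and h_ef: "x \<in> corner e f \<Longrightarrow> h x \<in> corner e f"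
    and h_fe: "x \<in> corner f e \<Longrightarrow> h x \<in> corner f e"
    and h_ff: "x \<in> corner f f \<Longrightarrow> h x \<in> corner f f"
    and h_lie: "h (lie_bracket x y) - lie_bracket (h x) y - lie_bracket x (h y) \<in> center UNIV"
begin

lemma swap_graded: "graded_lie_mod_center scale f e h"
proof -
  interpret s: faithful_peirce scale f e by (rule swap_faithful)
  show ?thesis by unfold_locales (use h_add h_ee h_ef h_fe h_ff h_lie in auto)
qed

lemma h_diff: "h (x - y) = h x - h y"
  using h_add[of "x - y" y] by (simp add: algebra_simps)

lemma h_zero [simp]: "h 0 = 0"
  using h_diff[of 0 0] by simp

text \<open>Off the diagonal the Lie law holds exactly, since the centre meets \<open>eAf\<close> only in \<open>0\<close>, and
  \<open>[a, m] = am\<close>.\<close>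

lemma leibniz_ee_ef:
  assumes a: "a \<in> corner e e" and m: "m \<in> corner e f"
  shows "h (a * m) = h a * m + a * h m"
proof -
  have "h (lie_bracket a m) - lie_bracket (h a) m - lie_bracket a (h m) = h (a * m) - h a * m - a * h m"
    using a m h_ee[OF a] h_ef[OF m] by (simp add: peirce_simps)
  moreover have "a * m \<in> corner e f" using a m by (simp add: peirce_simps)
  then have "h (a * m) - h a * m - a * h m \<in> corner e f"
    using a m h_ee[OF a] h_ef[OF m] h_ef[of "a * m"] by (simp add: peirce_simps)
  ultimately have "h (a * m) - h a * m - a * h m = 0"
    using central_in_off_diagonal[OF h_lie[of a m]] by simp
  then show ?thesis by (simp add: algebra_simps)
qed

lemma leibniz_ef_ff:
  assumes m: "m \<in> corner e f" and b: "b \<in> corner f f"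
  shows "h (m * b) = h m * b + m * h b"
proof -
  have "h (lie_bracket m b) - lie_bracket (h m) b - lie_bracket m (h b) = h (m * b) - h m * b - m * h b"
    using b m h_ff[OF b] h_ef[OF m] by (simp add: peirce_simps)
  moreover have "m * b \<in> corner e f" using b m by (simp add: peirce_simps)
  then have "h (m * b) - h m * b - m * h b \<in> corner e f"
    using b m h_ff[OF b] h_ef[OF m] h_ef[of "m * b"] by (simp add: peirce_simps)
  ultimately have "h (m * b) - h m * b - m * h b = 0"
    using central_in_off_diagonal[OF h_lie[of m b]] by simp
  then show ?thesis by (simp add: algebra_simps)
qed

text \<open>Tested on \<open>eAf\<close> and \<open>fAe\<close>, by expanding \<open>h (a a' m)\<close> and \<open>h (n a a')\<close> in two ways.\<close>

lemma leibniz_ee_ee: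
  assumes a: "a \<in> corner e e" and a': "a' \<in> corner e e"
  shows "h (a * a') = h a * a' + a * h a'"
proof -
  interpret s: graded_lie_mod_center scale f e h by (rule swap_graded)
  note aa' = corner_mult[OF a a']
  have "h (a * a') - (h a * a' + a * h a') = 0"
  proof (rule faithful_e)
    show "h (a * a') - (h a * a' + a * h a') \<in> corner e e"
      using aa' h_ee[OF aa'] a a' h_ee[OF a] h_ee[OF a'] by (simp add: peirce_simps)
    fix m assume m: "m \<in> corner e f"
    have "a' * m \<in> corner e f" using a' m by (simp add: peirce_simps)
    then have "h (a * (a' * m)) = h a * (a' * m) + a * (h a' * m + a' * h m)"
      using leibniz_ee_ef[OF a] leibniz_ee_ef[OF a' m] by simp
    then show "(h (a * a') - (h a * a' + a * h a')) * m = 0"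
      using leibniz_ee_ef[OF aa' m] by (simp add: algebra_simps)
  next
    fix n assume n: "n \<in> corner f e"
    have "n * a \<in> corner f e" using a n by (simp add: peirce_simps)
    then have "h (n * a * a') = (h n * a + n * h a) * a' + n * a * h a'"
      using s.leibniz_ef_ff[OF _ a'] s.leibniz_ef_ff[OF n a] by simp
    then show "n * (h (a * a') - (h a * a' + a * h a')) = 0"
      using s.leibniz_ef_ff[OF n aa'] by (simp add: algebra_simps)
  qed
  then show ?thesis by simp
qed

text \<open>The defects at \<open>mn\<close> and at \<open>nm\<close> are the two diagonal components of a central element. The one in
  \<open>eAe\<close> is linear for the action of \<open>eAe\<close> on \<open>m\<close>, the one in \<open>fAf\<close> for the action of \<open>fAf\<close> on \<open>n\<close>, so
  each of them generates a central ideal. One of them is therefore \<open>0\<close>, and then so is the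
  other, because a central element is determined by either component.\<close>

lemma leibniz_ef_fe:
  assumes no_ideal: "(\<forall>I. central_ideal scale (corner e e) I \<longrightarrow> I = {0}) \<or>
      (\<forall>I. central_ideal scale (corner f f) I \<longrightarrow> I = {0})"
    and m: "m \<in> corner e f" and n: "n \<in> corner f e"
  shows "h (m * n) = h m * n + m * h n" and "h (n * m) = h n * m + n * h m"
proof -
  interpret s: graded_lie_mod_center scale f e h by (rule swap_graded)
  define E where "E m n = h (m * n) - h m * n - m * h n" for m n
  have E_corner: "E m n \<in> corner e e" "E n m \<in> corner f f" if "m \<in> corner e f" "n \<in> corner f e" for m n
  proof -
    have "m * n \<in> corner e e" "n * m \<in> corner f f" using that by (simp_all add: peirce_simps)
    from h_ee[OF this(1)] h_ff[OF this(2)] show "E m n \<in> corner e e" "E n m \<in> corner f f"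
      using that h_ef[OF that(1)] h_fe[OF that(2)] by (simp_all add: E_def peirce_simps)
  qed
  have E_diff: "E m n - E n m \<in> center UNIV" for m n
  proof -
    have "h (lie_bracket m n) - lie_bracket (h m) n - lie_bracket m (h n) = E m n - E n m"
      by (simp add: E_def lie_bracket_def h_diff algebra_simps)
    with h_lie[of m n] show ?thesis by simp
  qed
  have E_central: "E m n \<in> center (corner e e)" "E n m \<in> center (corner f f)"
    if mn: "m \<in> corner e f" "n \<in> corner f e" for m n
  proof -
    have "e * (E m n - E n m) * e = E m n" "f * (E n m - E m n) * f = E n m"
      using E_corner[OF mn] by (simp_all add: peirce_simps)
    with central_component[OF E_diff[of m n]] s.central_component[OF E_diff[of n m]]
    show "E m n \<in> center (corner e e)" "E n m \<in> center (corner f f)" by simp_all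
  qed
  have "E m n = 0 \<and> E n m = 0"
    using no_ideal
  proof
    assume no_ideal: "\<forall>I. central_ideal scale (corner e e) I \<longrightarrow> I = {0}"
    have "E m n = 0"
    proof (rule central_ideal_generated)
      show "central_ideal scale (corner e e) I \<Longrightarrow> I = {0}" for I using no_ideal by blast
      show "E m n \<in> corner e e" using m n by (rule E_corner)
      fix a assume a: "a \<in> corner e e"
      have am: "a * m \<in> corner e f" and mn: "m * n \<in> corner e e" using a m n by (simp_all add: peirce_simps)
      have "a * E m n = E (a * m) n"
        unfolding E_def leibniz_ee_ef[OF a m] mult.assoc[of a m n] leibniz_ee_ee[OF a mn]
        by (simp add: algebra_simps)
      with E_central(1)[OF am n] show "a * E m n \<in> center (corner e e)" by simp
    qed
    moreover have "E n m = 0"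
      using s.central_zero[of "E n m"] E_diff[of n m] E_corner(2)[OF m n] \<open>E m n = 0\<close>
      by (simp add: peirce_simps)
    ultimately show ?thesis by simp
  next
    assume no_ideal: "\<forall>I. central_ideal scale (corner f f) I \<longrightarrow> I = {0}"
    have "E n m = 0"
    proof (rule s.central_ideal_generated)
      show "central_ideal scale (corner f f) I \<Longrightarrow> I = {0}" for I using no_ideal by blast
      show "E n m \<in> corner f f" using m n by (rule E_corner)
      fix b assume b: "b \<in> corner f f"
      have bn: "b * n \<in> corner f e" and nm: "n * m \<in> corner f f" using b m n by (simp_all add: peirce_simps)
      have "b * E n m = E (b * n) m"
        unfolding E_def s.leibniz_ee_ef[OF b n] mult.assoc[of b n m] s.leibniz_ee_ee[OF b nm]
        by (simp add: algebra_simps)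
      with E_central(2)[OF m bn] show "b * E n m \<in> center (corner f f)" by simp
    qed
    moreover have "E m n = 0"
      using central_zero[of "E m n"] E_diff[of m n] E_corner(1)[OF m n] \<open>E n m = 0\<close>
      by (simp add: peirce_simps)
    ultimately show ?thesis by simp
  qed
  then show "h (m * n) = h m * n + m * h n" "h (n * m) = h n * m + n * h m"
    by (simp_all add: E_def algebra_simps)
qed

lemma leibniz:
  assumes no_ideal: "(\<forall>I. central_ideal scale (corner e e) I \<longrightarrow> I = {0}) \<or>
      (\<forall>I. central_ideal scale (corner f f) I \<longrightarrow> I = {0})"
  shows "h (x * y) = h x * y + x * h y"
proof -
  interpret s: graded_lie_mod_center scale f e h by (rule swap_graded)
  define D where "D x y \<longleftrightarrow> h (x * y) = h x * y + x * h y" for x y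
  have add: "D x y \<Longrightarrow> D x' y \<Longrightarrow> D (x + x') y" "D x y \<Longrightarrow> D x y' \<Longrightarrow> D x (y + y')" for x x' y y'
    by (simp_all add: D_def distrib_left distrib_right h_add)
  have D_nonzero:
    "x \<in> corner e e \<Longrightarrow> y \<in> corner e e \<Longrightarrow> D x y" "x \<in> corner e e \<Longrightarrow> y \<in> corner e f \<Longrightarrow> D x y"
    "x \<in> corner e f \<Longrightarrow> y \<in> corner f e \<Longrightarrow> D x y" "x \<in> corner e f \<Longrightarrow> y \<in> corner f f \<Longrightarrow> D x y"
    "x \<in> corner f e \<Longrightarrow> y \<in> corner e e \<Longrightarrow> D x y" "x \<in> corner f e \<Longrightarrow> y \<in> corner e f \<Longrightarrow> D x y"
    "x \<in> corner f f \<Longrightarrow> y \<in> corner f e \<Longrightarrow> D x y" "x \<in> corner f f \<Longrightarrow> y \<in> corner f f \<Longrightarrow> D x y"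
    for x y
    unfolding D_def
    using leibniz_ee_ee leibniz_ee_ef leibniz_ef_fe[OF no_ideal] leibniz_ef_ff
      s.leibniz_ef_ff s.leibniz_ee_ef s.leibniz_ee_ee by blast+
  have D_zero:
    "x \<in> corner e e \<Longrightarrow> y \<in> corner f e \<Longrightarrow> D x y" "x \<in> corner e e \<Longrightarrow> y \<in> corner f f \<Longrightarrow> D x y"
    "x \<in> corner e f \<Longrightarrow> y \<in> corner e e \<Longrightarrow> D x y" "x \<in> corner e f \<Longrightarrow> y \<in> corner e f \<Longrightarrow> D x y"
    "x \<in> corner f e \<Longrightarrow> y \<in> corner f e \<Longrightarrow> D x y" "x \<in> corner f e \<Longrightarrow> y \<in> corner f f \<Longrightarrow> D x y"
    "x \<in> corner f f \<Longrightarrow> y \<in> corner e e \<Longrightarrow> D x y" "x \<in> corner f f \<Longrightarrow> y \<in> corner e f \<Longrightarrow> D x y"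
    for x y
    unfolding D_def
    using h_ee[of x] h_ef[of x] h_fe[of x] h_ff[of x] h_ee[of y] h_ef[of y] h_fe[of y] h_ff[of y]
    by (simp_all add: peirce_simps)
  have "D x y"
    by (subst peirce_sum[of x], subst peirce_sum[of y])
      (intro add; simp add: D_nonzero D_zero corner_component)
  then show ?thesis by (simp add: D_def)
qed

end

section \<open>Lie \<open>n\<close>-derivations that are diagonal at the idempotent\<close>

text \<open>The normalisation that \<open>\<phi> e\<close> is diagonal is achieved in the end by an inner derivation.\<close>

locale peirce_lie = faithful_peirce scale e f
  for scale :: "'r::comm_ring_1 \<Rightarrow> 'a::ring_1 \<Rightarrow> 'a" and e f :: 'a +
  fixes \<phi> :: "'a \<Rightarrow> 'a" and n :: nat
  assumes lie: "lie_n_derivation scale n \<phi>" and n_ge_2: "n \<ge> 2"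
    and tf2: "torsion_free 2 TYPE('a)" and tfn: "torsion_free (n - 1) TYPE('a)"
    and phi_e_diagonal: "e * \<phi> e * f = 0" "f * \<phi> e * e = 0"
begin

sublocale phi: module_hom scale scale \<phi>
  using lie by (simp add: lie_n_derivation_def)

lemma phi_lie_p: "\<phi> (lie_p n x) = lie_p_sum \<phi> n x"
  using lie by (simp add: lie_n_derivation_iff)

abbreviation ad_e :: "nat \<Rightarrow> 'a \<Rightarrow> 'a" where
  "ad_e k \<equiv> (\<lambda>x. lie_bracket x e) ^^ k"

lemma ad_e_eigen:
  assumes "lie_bracket y e = s * y" and "s = 1 \<or> s = - 1"
  shows "ad_e k y = s ^ k * y"
proof (induction k)
  case (Suc k)
  have "lie_bracket (s ^ k * y) e = s ^ k * lie_bracket y e"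
  proof -
    have "e * s ^ k = s ^ k * e" using assms(2) by (cases "even k") auto
    then have "e * (s ^ k * y) = s ^ k * (e * y)" by (simp flip: mult.assoc)
    then show ?thesis by (simp add: lie_bracket_def right_diff_distrib mult.assoc)
  qed
  then show ?case using Suc assms(1) by (simp add: power_commutes flip: mult.assoc)
qed simp

text \<open>The commutator \<open>[y, e, \<dots>, e]\<close> vanishes, and only its first entry contributes to the Leibniz sum.\<close>

lemma phi_diagonal_element:
  assumes "lie_bracket y e = 0" and "lie_bracket y (\<phi> e) = 0"
  shows "e * \<phi> y * f = 0" and "f * \<phi> y * e = 0"
proof -
  define x :: "nat \<Rightarrow> 'a" where "x i = (if i = 1 then y else e)" for i
  have p: "lie_p (Suc j) x = ad_e j y" for j
    using lie_p_tail[of 1 x e j] by (simp add: x_def)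
  have p_zero: "ad_e (Suc j) y = 0" for j
    by (induction j) (simp_all add: assms(1), simp add: lie_bracket_def)
  have "lie_bracket (lie_p (Suc j) x) (\<phi> e) = 0" for j
    by (cases j) (simp_all add: p p_zero assms(2) del: funpow.simps, simp_all add: lie_bracket_def assms(2))
  then have s: "lie_p_sum \<phi> (Suc j) x = ad_e j (\<phi> y)" for j
    by (induction j) (simp_all add: lie_p_sum_1 lie_p_sum_Suc x_def)
  obtain k where k: "n = Suc (Suc k)" using n_ge_2 by (metis add_2_eq_Suc le_Suc_ex)
  have "ad_e (Suc k) (\<phi> y) = 0" using phi_lie_p[of x] unfolding k p s p_zero by simp
  with bracket_e_funpow(1,2)[of "Suc k" "\<phi> y"]
  show "e * \<phi> y * f = 0" "f * \<phi> y * e = 0" by (cases "even k"; simp)+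
qed

lemma phi_f_diagonal: "e * \<phi> f * f = 0" "f * \<phi> f * e = 0"
proof -
  have "lie_bracket f (\<phi> e) = 0"
    using commute_of_diagonal[OF phi_e_diagonal] by (simp add: lie_bracket_def)
  moreover have "lie_bracket f e = 0" by (simp add: peirce_simps)
  ultimately show "e * \<phi> f * f = 0" "f * \<phi> f * e = 0"
    using phi_diagonal_element by auto
qed

lemma swap_lie: "peirce_lie scale f e \<phi> n"
proof -
  interpret s: faithful_peirce scale f e by (rule swap_faithful)
  show ?thesis
    by unfold_locales (use lie n_ge_2 tf2 tfn phi_f_diagonal in auto)
qed

text \<open>For \<open>y\<close> in an eigenspace of \<open>[\<cdot>, e]\<close>, each of the \<open>n - 1\<close> entries \<open>e\<close> contributes the same multiple
  of \<open>[y, \<phi> e]\<close>. The eigenvalue \<open>s\<close> is its own inverse, so that \<open>s ^ (n - 2) = s ^ n\<close>.\<close>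

lemma phi_off_diagonal_element:
  assumes y: "lie_bracket y e = s * y" and c: "lie_bracket (lie_bracket y (\<phi> e)) e = s * lie_bracket y (\<phi> e)"
    and s: "s = 1 \<or> s = - 1"
  shows "\<phi> (s ^ (n - 1) * y) = ad_e (n - 1) (\<phi> y) + of_nat (n - 1) * s ^ n * lie_bracket y (\<phi> e)"
proof -
  define x :: "nat \<Rightarrow> 'a" where "x i = (if i = 1 then y else e)" for i
  have p: "lie_p (Suc j) x = s ^ j * y" for j
    using lie_p_tail[of 1 x e j] by (simp add: x_def ad_e_eigen[OF y s])
  have comm: "s * z = z * s" for z using s by auto
  have ss: "s * (s * z) = z" for z using s by auto
  have bracket_scale: "lie_bracket (t * z) w = t * lie_bracket z w"
    if "t * w = w * t" for t z w :: 'a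
    using that by (simp add: lie_bracket_def right_diff_distrib mult.assoc) (metis mult.assoc)
  have s_pow: "s ^ j * z = z * s ^ j" for z j using s by (cases "even j") auto
  have sum: "lie_p_sum \<phi> (Suc j) x = ad_e j (\<phi> y) + of_nat j * s ^ Suc j * lie_bracket y (\<phi> e)" for j
  proof (induction j)
    case (Suc j)
    let ?c = "lie_bracket y (\<phi> e)"
    have "of_nat j * s ^ Suc j * e = e * (of_nat j * s ^ Suc j)"
      by (metis mult.assoc mult_of_nat_commute s_pow)
    then have "lie_bracket (of_nat j * s ^ Suc j * ?c) e = of_nat j * s ^ Suc j * (s * ?c)"
      by (simp only: bracket_scale c)
    moreover have "lie_bracket (s ^ j * y) (\<phi> e) = s ^ Suc (Suc j) * ?c"
      unfolding bracket_scale[OF s_pow] by (simp add: ss mult.assoc)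
    ultimately have "lie_p_sum \<phi> (Suc (Suc j)) x = ad_e (Suc j) (\<phi> y)
        + of_nat j * s ^ Suc j * (s * ?c) + s ^ Suc (Suc j) * ?c"
      by (simp add: lie_p_sum_Suc Suc p lie_bracket_add_left del: power_Suc) (simp add: x_def)
    also have "of_nat j * s ^ Suc j * (s * ?c) = of_nat j * s ^ Suc (Suc j) * ?c"
      by (simp only: power_Suc2[of s "Suc j"] mult.assoc)
    finally show ?case by (simp add: distrib_right add.assoc del: power_Suc)
  qed (simp add: lie_p_sum_1 x_def)
  obtain k where k: "n = Suc k" using n_ge_2 by (cases n) auto
  show ?thesis using phi_lie_p[of x] unfolding k p sum by simp
qed

lemma phi_ef_expansion:
  assumes m: "m \<in> corner e f"
  shows "\<phi> ((- 1) ^ (n - 1) * m)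
    = ad_e (n - 1) (\<phi> m) + of_nat (n - 1) * (- 1) ^ n * lie_bracket m (\<phi> e)"
    and "lie_bracket m (\<phi> e) \<in> corner e f"
proof -
  let ?c = "\<phi> e"
  show c: "lie_bracket m ?c \<in> corner e f" by (rule bracket_diagonal_corner[OF phi_e_diagonal m])
  show "\<phi> ((- 1) ^ (n - 1) * m)
    = ad_e (n - 1) (\<phi> m) + of_nat (n - 1) * (- 1) ^ n * lie_bracket m (\<phi> e)"
  proof (rule phi_off_diagonal_element)
    show "lie_bracket m e = - 1 * m" using m by (simp add: peirce_simps)
    have "lie_bracket z e = - 1 * z" if "z \<in> corner e f" for z using that by (simp add: peirce_simps)
    then show "lie_bracket (lie_bracket m ?c) e = - 1 * lie_bracket m ?c" using c .
  qed simp
qed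

lemma phi_fe_expansion:
  assumes m: "m \<in> corner f e"
  shows "\<phi> m = ad_e (n - 1) (\<phi> m) + of_nat (n - 1) * lie_bracket m (\<phi> e)"
    and "lie_bracket m (\<phi> e) \<in> corner f e"
proof -
  interpret s: faithful_peirce scale f e by (rule swap_faithful)
  show c: "lie_bracket m (\<phi> e) \<in> corner f e"
    by (rule s.bracket_diagonal_corner[OF phi_e_diagonal(2,1) m])
  have "lie_bracket z e = 1 * z" if "z \<in> corner f e" for z using that by (simp add: peirce_simps)
  from phi_off_diagonal_element[OF this[OF m] this[OF c]]
  show "\<phi> m = ad_e (n - 1) (\<phi> m) + of_nat (n - 1) * lie_bracket m (\<phi> e)" by simp
qed

lemma phi_minus_one_power: "\<phi> ((- 1) ^ k * x) = (- 1) ^ k * \<phi> x"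
  by (cases "even k") (simp_all add: phi.neg)

text \<open>The components in \<open>eAf\<close> and \<open>fAe\<close> of the two expansions leave \<open>(n - 1) [m, \<phi> e] = 0\<close>.\<close>

lemma phi_e_central: "\<phi> e \<in> center UNIV"
proof (rule diagonal_centralI)
  have zero: "y = 0" if "of_nat (n - 1) * y = 0" for y :: 'a
    using tfn that unfolding torsion_free_def by blast
  fix m assume m: "m \<in> corner e f"
  let ?y = "(- 1) ^ n * lie_bracket m (\<phi> e)"
  have y: "e * ?y * f = ?y"
    using phi_ef_expansion(2)[OF m] by (cases "even n") (simp_all add: in_corner_iff absorbs_simps)
  have "e * \<phi> ((- 1) ^ (n - 1) * m) * f
      = e * (ad_e (n - 1) (\<phi> m) + of_nat (n - 1) * ?y) * f"
    unfolding phi_ef_expansion(1)[OF m] by (simp add: mult.assoc)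
  also have "\<dots> = (- 1) ^ (n - 1) * (e * \<phi> m * f) + of_nat (n - 1) * (e * ?y * f)"
    unfolding distrib_left distrib_right bracket_e_funpow(1)
    by (metis mult.assoc mult_of_nat_commute)
  also have "e * \<phi> ((- 1) ^ (n - 1) * m) * f = (- 1) ^ (n - 1) * (e * \<phi> m * f)"
    unfolding phi_minus_one_power by (cases "even (n - 1)") simp_all
  finally have "?y = 0" unfolding y using zero by simp
  then show "\<phi> e * m = m * \<phi> e" by (cases "even n") (simp_all add: lie_bracket_def)
next
  have zero: "y = 0" if "of_nat (n - 1) * y = 0" for y :: 'a
    using tfn that unfolding torsion_free_def by blast
  fix m assume m: "m \<in> corner f e"
  let ?y = "lie_bracket m (\<phi> e)"
  have y: "f * ?y * e = ?y"
    using phi_fe_expansion(2)[OF m] by (simp add: in_corner_iff absorbs_simps)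
  have "f * \<phi> m * e = f * (ad_e (n - 1) (\<phi> m) + of_nat (n - 1) * ?y) * e"
    by (subst phi_fe_expansion(1)[OF m]) rule
  also have "\<dots> = f * \<phi> m * e + of_nat (n - 1) * (f * ?y * e)"
    unfolding distrib_left distrib_right bracket_e_funpow(2)
    by (metis mult.assoc mult_of_nat_commute)
  finally have "?y = 0" unfolding y using zero by simp
  then show "\<phi> e * m = m * \<phi> e" by (simp add: lie_bracket_def)
qed (use phi_e_diagonal in auto)

lemma bracket_phi_e: "lie_bracket y (\<phi> e) = 0"
  using phi_e_central by (simp_all add: center_def lie_bracket_def)

lemma phi_ee:
  assumes "a \<in> corner e e"
  shows "e * \<phi> a * f = 0" and "f * \<phi> a * e = 0" and "\<phi> a = e * \<phi> a * e + f * \<phi> a * f"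
proof -
  have "lie_bracket a e = 0" using assms by (simp add: peirce_simps)
  then show "e * \<phi> a * f = 0" "f * \<phi> a * e = 0"
    using phi_diagonal_element bracket_phi_e by auto
  then show "\<phi> a = e * \<phi> a * e + f * \<phi> a * f" using peirce_sum[of "\<phi> a"] by simp
qed

text \<open>The expansion of \<open>\<phi> m\<close> equates \<open>(-1) ^ (n - 1) \<phi> m\<close> with an image of \<open>[\<cdot>, e]\<close>; this excludes
  diagonal components, and for even \<open>n\<close> it gives opposite signs to the component in \<open>fAe\<close>.\<close>

lemma phi_ef:
  assumes m: "m \<in> corner e f"
  shows "\<phi> m = e * \<phi> m * f + f * \<phi> m * e" and "even n \<Longrightarrow> f * \<phi> m * e = 0"
proof -
  have n1: "n - 1 > 0" using n_ge_2 by simp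
  have eq: "(- 1) ^ (n - 1) * \<phi> m = ad_e (n - 1) (\<phi> m)"
    using phi_ef_expansion(1)[OF m] by (simp add: bracket_phi_e phi_minus_one_power)
  have sgn: "x * ((- 1) ^ (n - 1) * \<phi> m) * y = (- 1) ^ (n - 1) * (x * \<phi> m * y)" for x y
    by (cases "even (n - 1)") simp_all
  have "e * \<phi> m * e = 0" "f * \<phi> m * f = 0"
    using sgn[of e e] sgn[of f f] unfolding eq bracket_e_funpow(3,4)[OF n1]
    by (cases "even (n - 1)"; simp)+
  then show "\<phi> m = e * \<phi> m * f + f * \<phi> m * e" using peirce_sum[of "\<phi> m"] by simp
  assume "even n"
  then have "odd (n - 1)" using n_ge_2 by simp
  then have "f * \<phi> m * e = - (f * \<phi> m * e)"
    using sgn[of f e] unfolding eq bracket_e_funpow(2) by simp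
  then have "f * \<phi> m * e + f * \<phi> m * e = 0" by (metis add.right_inverse)
  then show "f * \<phi> m * e = 0" by (rule torsion_free_2D[OF tf2])
qed

text \<open>Now that \<open>\<phi> e\<close> is central, the trailing entries in \<open>x, y, e, \<dots>, e\<close> contribute nothing to the
  Leibniz sum; likewise below for \<open>x, y, z, e, \<dots>, e\<close>.\<close>

lemma phi_bracket: "\<phi> (ad_e (n - 2) (lie_bracket x y))
    = ad_e (n - 2) (lie_bracket (\<phi> x) y + lie_bracket x (\<phi> y))"
proof -
  define s :: "nat \<Rightarrow> 'a" where "s i = (if i = 1 then x else if i = 2 then y else e)" for i
  have n: "Suc (Suc 0) + (n - 2) = n" using n_ge_2 by simp
  have "s i = e" if "Suc (Suc 0) < i" for i using that by (simp add: s_def)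
  from lie_p_tail[of "Suc (Suc 0)" s e "n - 2", OF _ this]
    lie_p_sum_tail[of "Suc (Suc 0)" s e \<phi> "n - 2", OF _ this bracket_phi_e]
  have "lie_p n s = ad_e (n - 2) (lie_p (Suc (Suc 0)) s)"
    "lie_p_sum \<phi> n s = ad_e (n - 2) (lie_p_sum \<phi> (Suc (Suc 0)) s)"
    unfolding n by simp_all
  then show ?thesis using phi_lie_p[of s] by (simp add: lie_p_sum_Suc lie_p_sum_1 s_def)
qed

lemma phi_double_bracket:
  assumes "n \<ge> 3"
  shows "\<phi> (ad_e (n - 3) (lie_bracket (lie_bracket x y) z))
    = ad_e (n - 3) (lie_bracket (lie_bracket (\<phi> x) y + lie_bracket x (\<phi> y)) z
        + lie_bracket (lie_bracket x y) (\<phi> z))"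
proof -
  define s :: "nat \<Rightarrow> 'a" where
    "s i = (if i = 1 then x else if i = 2 then y else if i = 3 then z else e)" for i
  have n: "Suc (Suc (Suc 0)) + (n - 3) = n" using assms by simp
  have "s i = e" if "Suc (Suc (Suc 0)) < i" for i using that by (simp add: s_def)
  from lie_p_tail[of "Suc (Suc (Suc 0))" s e "n - 3", OF _ this]
    lie_p_sum_tail[of "Suc (Suc (Suc 0))" s e \<phi> "n - 3", OF _ this bracket_phi_e]
  have "lie_p n s = ad_e (n - 3) (lie_p (Suc (Suc (Suc 0))) s)"
    "lie_p_sum \<phi> n s = ad_e (n - 3) (lie_p_sum \<phi> (Suc (Suc (Suc 0))) s)"
    unfolding n by simp_all
  then show ?thesis using phi_lie_p[of s] by (simp add: lie_p_sum_Suc lie_p_sum_1 s_def)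
qed

lemma ad_e_ef: "m \<in> corner e f \<Longrightarrow> ad_e k m = (- 1) ^ k * m"
  by (rule ad_e_eigen) (simp_all add: peirce_simps)

end

context peirce_lie
begin

text \<open>For odd \<open>n\<close> the component \<open>\<nu>\<close> of \<open>\<phi>\<close> from \<open>eAf\<close> to \<open>fAe\<close> satisfies the hypotheses of
  \<open>twisted_map_zero\<close>. The module identities come from \<open>[a, m] = am\<close> and \<open>[m, b] = mb\<close>, the identity
  \<open>skew\<close> from \<open>[[m1, m2], m3] = 0\<close>, and \<open>anti\<close> from the two computations of \<open>\<nu>\<close> at
  \<open>[[m1, n'], m2] = m1 n' m2 + m2 n' m1\<close>.\<close>

lemma phi_ef_preserved:
  assumes no_ideal: "(\<forall>I. central_ideal scale (corner e e) I \<longrightarrow> I = {0}) \<or>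
      (\<forall>I. central_ideal scale (corner f f) I \<longrightarrow> I = {0})"
    and N_zero: "\<And>n. n \<in> corner f e \<Longrightarrow> (\<And>m. m \<in> corner e f \<Longrightarrow> m * n = 0) \<Longrightarrow>
      (\<And>m. m \<in> corner e f \<Longrightarrow> n * m = 0) \<Longrightarrow> n = 0"
    and m: "m \<in> corner e f"
  shows "\<phi> m \<in> corner e f"
proof -
  let ?M = "corner e f" and ?N = "corner f e" and ?A = "corner e e" and ?B = "corner f f"
  define \<nu> where "\<nu> m = f * \<phi> m * e" for m
  have "\<nu> m = 0"
  proof (cases "even n")
    case True
    with phi_ef(2)[OF m] show ?thesis by (simp add: \<nu>_def)
  next
    case odd: False
    then have n3: "n \<ge> 3" using n_ge_2 by (cases "n = 2") auto
    have odd2: "odd (n - 2)" and even3: "even (n - 3)" using odd n3 by auto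
    \<comment> \<open>The minus sign is \<open>(-1) ^ (n - 2)\<close>, the scalar by which the power of \<open>[\<cdot>, e]\<close> acts on \<open>z\<close>.\<close>
    have nu_bracket: "\<nu> z = - (f * (lie_bracket (\<phi> x) y + lie_bracket x (\<phi> y)) * e)"
      if "lie_bracket x y = z" "z \<in> ?M" for x y z
    proof -
      have "ad_e (n - 2) z = - z" using ad_e_ef[OF that(2)] odd2 by simp
      with phi_bracket[of x y] that(1)
      have "- \<phi> z = ad_e (n - 2) (lie_bracket (\<phi> x) y + lie_bracket x (\<phi> y))" by (simp add: phi.neg)
      then have "f * (- \<phi> z) * e = f * (lie_bracket (\<phi> x) y + lie_bracket x (\<phi> y)) * e"
        by (simp only: bracket_e_funpow(2))
      then show ?thesis unfolding \<nu>_def by (metis minus_minus mult_minus_left mult_minus_right)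
    qed
    have \<nu>_left: "\<nu> (a * m) = \<nu> m * a" if a: "a \<in> ?A" and m: "m \<in> ?M" for a m
    proof -
      have "lie_bracket a m = a * m" "a * m \<in> ?M" using a m by (simp_all add: peirce_simps)
      then have "\<nu> (a * m) = - (f * (lie_bracket (\<phi> a) m + lie_bracket a (\<phi> m)) * e)"
        by (rule nu_bracket)
      also have "\<dots> = \<nu> m * a" unfolding \<nu>_def using a m by (simp add: peirce_simps)
      finally show ?thesis .
    qed
    have \<nu>_right: "\<nu> (m * b) = b * \<nu> m" if m: "m \<in> ?M" and b: "b \<in> ?B" for m b
    proof -
      have "lie_bracket m b = m * b" "m * b \<in> ?M" using b m by (simp_all add: peirce_simps)
      then have "\<nu> (m * b) = - (f * (lie_bracket (\<phi> m) b + lie_bracket m (\<phi> b)) * e)"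
        by (rule nu_bracket)
      also have "\<dots> = b * \<nu> m" unfolding \<nu>_def using b m by (simp add: peirce_simps)
      finally show ?thesis .
    qed
    have skew: "(m1 * \<nu> m2 - m2 * \<nu> m1) * m3 = m3 * (\<nu> m1 * m2 - \<nu> m2 * m1)"
      if m: "m1 \<in> ?M" "m2 \<in> ?M" "m3 \<in> ?M" for m1 m2 m3
    proof -
      have zero: "lie_bracket m1 m2 = 0" using m by (simp add: peirce_simps)
      let ?w = "lie_bracket (lie_bracket (\<phi> m1) m2 + lie_bracket m1 (\<phi> m2)) m3"
      have "ad_e (n - 3) ?w = \<phi> (ad_e (n - 3) 0)"
        using phi_double_bracket[OF n3, of m1 m2 m3] by (simp add: zero lie_bracket_zero)
      also have "ad_e (n - 3) 0 = 0" using ad_e_ef[of 0 "n - 3"] by (simp add: peirce_simps)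
      finally have "e * ?w * f = 0"
        using bracket_e_funpow(1)[of "n - 3" ?w] even3 by simp
      then show ?thesis unfolding \<nu>_def using m by (simp add: peirce_simps algebra_simps)
    qed
    have anti: "\<nu> m2 * m1 * n' = - (n' * m1 * \<nu> m2)"
      if m: "m1 \<in> ?M" "m2 \<in> ?M" and n': "n' \<in> ?N" for m1 m2 n'
    proof -
      let ?z = "lie_bracket (lie_bracket m1 n') m2"
      have z: "?z = m1 * n' * m2 + m2 * (n' * m1)" "?z \<in> ?M" using m n' by (simp_all add: peirce_simps)
      have c: "m1 * n' \<in> ?A" "n' * m1 \<in> ?B" using m n' by (simp_all add: peirce_simps)
      have "\<nu> ?z = \<nu> (m1 * n' * m2) + \<nu> (m2 * (n' * m1))"
        unfolding z(1) by (simp add: \<nu>_def phi.add algebra_simps)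
      also have "\<dots> = \<nu> m2 * (m1 * n') + n' * m1 * \<nu> m2"
        using \<nu>_left[OF c(1) m(2)] \<nu>_right[OF m(2) c(2)] by simp
      finally have 1: "\<nu> ?z = \<nu> m2 * (m1 * n') + n' * m1 * \<nu> m2" .
      have "ad_e (n - 3) ?z = ?z" using ad_e_ef[OF z(2), of "n - 3"] even3 by simp
      then have "\<nu> ?z = f * (lie_bracket (lie_bracket (\<phi> m1) n' + lie_bracket m1 (\<phi> n')) m2
          + lie_bracket (lie_bracket m1 n') (\<phi> m2)) * e"
        using phi_double_bracket[OF n3, of m1 n' m2] unfolding \<nu>_def by (simp add: bracket_e_funpow(2))
      also have "\<dots> = - (\<nu> m2 * (m1 * n') + n' * m1 * \<nu> m2)"
        unfolding \<nu>_def using m n' by (simp add: peirce_simps)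
      finally have "\<nu> ?z = - \<nu> ?z" by (simp only: 1)
      then have "\<nu> ?z + \<nu> ?z = 0" by (metis add.right_inverse)
      then have "\<nu> ?z = 0" by (rule torsion_free_2D[OF tf2])
      with 1 show ?thesis by (simp add: mult.assoc eq_neg_iff_add_eq_0)
    qed
    show ?thesis
      by (rule twisted_map_zero[OF no_ideal tf2 N_zero _ \<nu>_left \<nu>_right skew anti m])
        (simp_all add: \<nu>_def corner_component)
  qed
  then have "\<phi> m = e * \<phi> m * f" using phi_ef(1)[OF m] by (simp add: \<nu>_def)
  then show ?thesis using corner_component(2)[of "\<phi> m"] by simp
qed

end

section \<open>The Lie law modulo the centre\<close>

locale graded_peirce_lie = peirce_lie scale e f \<phi> n
  for scale :: "'r::comm_ring_1 \<Rightarrow> 'a::ring_1 \<Rightarrow> 'a" and e f :: 'a and \<phi> :: "'a \<Rightarrow> 'a" and n +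
  assumes phi_ef_mem: "m \<in> corner e f \<Longrightarrow> \<phi> m \<in> corner e f"
    and phi_fe_mem: "m \<in> corner f e \<Longrightarrow> \<phi> m \<in> corner f e"
begin

lemma swap_graded_lie: "graded_peirce_lie scale f e \<phi> n"
proof -
  interpret s: peirce_lie scale f e \<phi> n by (rule swap_lie)
  show ?thesis by unfold_locales (fact phi_fe_mem phi_ef_mem)+
qed

definition defect :: "'a \<Rightarrow> 'a \<Rightarrow> 'a" where
  "defect x y = \<phi> (lie_bracket x y) - lie_bracket (\<phi> x) y - lie_bracket x (\<phi> y)"

lemma phi_component: "e * \<phi> x * f = \<phi> (e * x * f)" "f * \<phi> x * e = \<phi> (f * x * e)"
proof -
  interpret s: peirce_lie scale f e \<phi> n by (rule swap_lie)
  have "\<phi> x = \<phi> (e * x * e) + \<phi> (e * x * f) + \<phi> (f * x * e) + \<phi> (f * x * f)"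
    by (subst peirce_sum[of x]) (simp add: phi.add)
  moreover note phi_ee(1,2)[OF corner_component(1), of x] s.phi_ee(1,2)[OF corner_component(4), of x]
    phi_ef_mem[OF corner_component(2), of x] phi_fe_mem[OF corner_component(3), of x]
  ultimately show "e * \<phi> x * f = \<phi> (e * x * f)" "f * \<phi> x * e = \<phi> (f * x * e)"
    by (simp_all add: distrib_left distrib_right in_corner_iff absorbs_simps)
qed

text \<open>On the off-diagonal corners \<open>\<phi>\<close> commutes with \<open>[\<cdot>, e]\<close>, which is invertible there.\<close>

lemma off_diagonal_phi_ad_e:
  assumes "\<phi> (ad_e k x) = ad_e k y"
  shows "e * (\<phi> x - y) * f = 0" "f * (\<phi> x - y) * e = 0"
proof -
  have "e * \<phi> (ad_e k x) * f = (- 1) ^ k * (e * \<phi> x * f)"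
    unfolding phi_component bracket_e_funpow phi_minus_one_power ..
  then have "(- 1) ^ k * (e * \<phi> x * f) = (- 1) ^ k * (e * y * f)"
    unfolding assms bracket_e_funpow by simp
  then have "e * \<phi> x * f = e * y * f" by (cases "even k") auto
  then show "e * (\<phi> x - y) * f = 0" by (simp add: algebra_simps)
  have "f * \<phi> (ad_e k x) * e = f * \<phi> x * e"
    unfolding phi_component bracket_e_funpow ..
  then show "f * (\<phi> x - y) * e = 0"
    unfolding assms bracket_e_funpow by (simp add: algebra_simps)
qed

lemma defect_diagonal: "e * defect x y * f = 0" "f * defect x y * e = 0"
  using off_diagonal_phi_ad_e[OF phi_bracket[of x y]] by (simp_all add: defect_def diff_diff_eq)

text \<open>By the law for double commutators, \<open>[defect x y, z]\<close> has no off-diagonal component. For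
  \<open>z\<close> in \<open>eAf\<close> or \<open>fAe\<close> it is off-diagonal itself, the defect being diagonal; so it is \<open>0\<close>. For
  \<open>n = 2\<close> there is no law for double commutators, but the defect itself is \<open>0\<close>.\<close>

lemma defect_central: "defect x y \<in> center UNIV"
proof (cases "n = 2")
  case True
  then have "defect x y = 0" using phi_bracket[of x y] by (simp add: defect_def)
  then show ?thesis by (simp add: center_def)
next
  case False
  then have n3: "n \<ge> 3" using n_ge_2 by simp
  have "e * lie_bracket (defect x y) z * f = 0 \<and> f * lie_bracket (defect x y) z * e = 0" for z
  proof -
    let ?w = "lie_bracket (lie_bracket (\<phi> x) y + lie_bracket x (\<phi> y)) z
        + lie_bracket (lie_bracket x y) (\<phi> z)"
    have "lie_bracket (defect x y) z
        = (\<phi> (lie_bracket (lie_bracket x y) z) - ?w) - defect (lie_bracket x y) z"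
      by (simp add: defect_def lie_bracket_diff_left lie_bracket_add_left)
    then show ?thesis
      using off_diagonal_phi_ad_e[OF phi_double_bracket[OF n3, of x y z]] defect_diagonal[of "lie_bracket x y" z]
      by (simp only: right_diff_distrib left_diff_distrib) simp
  qed
  note off = this
  interpret s: faithful_peirce scale f e by (rule swap_faithful)
  show ?thesis
  proof (rule diagonal_centralI[OF defect_diagonal])
    show "defect x y * m = m * defect x y" if m: "m \<in> corner e f" for m
    proof -
      have "e * lie_bracket m (defect x y) * f = 0"
        using off[of m] by (subst lie_bracket_swap) simp
      then have "lie_bracket m (defect x y) = 0"
        using bracket_diagonal_corner[OF defect_diagonal m, of x y] by (simp only: in_corner_iff) (simp add: absorbs_simps)
      then show ?thesis by (simp add: lie_bracket_def)
    qed
    show "defect x y * m = m * defect x y" if m: "m \<in> corner f e" for m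
    proof -
      have "f * lie_bracket m (defect x y) * e = 0"
        using off[of m] by (subst lie_bracket_swap) simp
      then have "lie_bracket m (defect x y) = 0"
        using s.bracket_diagonal_corner[OF defect_diagonal(2,1) m, of x y] by (simp only: in_corner_iff) (simp add: absorbs_simps)
      then show ?thesis by (simp add: lie_bracket_def)
    qed
  qed
qed

end

section \<open>Central parts on the diagonal corners\<close>

context graded_peirce_lie
begin

lemma law_ee_ef:
  assumes a: "a \<in> corner e e" and m: "m \<in> corner e f"
  shows "\<phi> (a * m) = \<phi> a * m - m * \<phi> a + a * \<phi> m"
proof -
  have am: "a * m \<in> corner e f" "lie_bracket a m = a * m" using a m by (simp_all add: peirce_simps)
  have 2: "lie_bracket a (\<phi> m) = a * \<phi> m" "a * \<phi> m \<in> corner e f"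
    using a phi_ef_mem[OF m] by (simp_all add: peirce_simps)
  have 1: "- lie_bracket m (\<phi> a) \<in> corner e f"
    using bracket_diagonal_corner[OF phi_ee(1,2)[OF a] m] by (simp only: in_corner_iff absorbs_left_closed absorbs_right_closed)
  have "e * defect a m * f = \<phi> (a * m) - (- lie_bracket m (\<phi> a)) - a * \<phi> m"
    using 1 2 phi_ef_mem[OF am(1)] lie_bracket_swap[of "\<phi> a" m]
    by (simp only: defect_def am(2) in_corner_iff left_diff_distrib right_diff_distrib absorbs_simps)
  then show ?thesis unfolding defect_diagonal(1) by (simp add: lie_bracket_def algebra_simps)
qed

lemma law_fe_ee:
  assumes a: "a \<in> corner e e" and m: "m \<in> corner f e"
  shows "\<phi> (m * a) = \<phi> m * a + m * \<phi> a - \<phi> a * m"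
proof -
  interpret s: peirce scale f e by (rule swap_peirce)
  have ma: "m * a \<in> corner f e" "lie_bracket m a = m * a" using a m by (simp_all add: peirce_simps)
  have 2: "lie_bracket (\<phi> m) a = \<phi> m * a" "\<phi> m * a \<in> corner f e"
    using a phi_fe_mem[OF m] by (simp_all add: peirce_simps)
  have 1: "lie_bracket m (\<phi> a) \<in> corner f e"
    using s.bracket_diagonal_corner[OF phi_ee(2,1)[OF a] m] .
  have "f * defect m a * e = \<phi> (m * a) - \<phi> m * a - lie_bracket m (\<phi> a)"
    using 1 2 phi_fe_mem[OF ma(1)]
    by (simp only: defect_def ma(2) in_corner_iff left_diff_distrib right_diff_distrib absorbs_simps)
  then show ?thesis unfolding defect_diagonal(2) by (simp add: lie_bracket_def algebra_simps)
qed

text \<open>The element \<open>a\<close> of \<open>eAe\<close> has its image in \<open>eAe + Z\<close>: the component of \<open>\<phi> a\<close> in \<open>fAf\<close>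
  extends to a central element, which can be subtracted.\<close>

definition corner_mod_center :: "'a \<Rightarrow> bool" where
  "corner_mod_center a \<longleftrightarrow> (\<exists>d \<in> corner e e. \<phi> a - d \<in> center UNIV)"

text \<open>The commutators of \<open>\<phi> x\<close> with the off-diagonal corners suffice: they must be those of an element
  of \<open>eAe\<close>.\<close>

lemma corner_mod_centerI:
  assumes x: "x \<in> corner e e" and d: "d \<in> corner e e"
    and M: "\<And>m. m \<in> corner e f \<Longrightarrow> \<phi> x * m - m * \<phi> x = d * m"
    and N: "\<And>m. m \<in> corner f e \<Longrightarrow> m * \<phi> x - \<phi> x * m = m * d"
  shows "corner_mod_center x"
  unfolding corner_mod_center_def
proof (rule bexI[OF _ d], rule diagonal_centralI)
  have "e * d * f = 0" "f * d * e = 0" using d by (simp_all add: peirce_simps)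
  then show "e * (\<phi> x - d) * f = 0" "f * (\<phi> x - d) * e = 0"
    using phi_ee(1,2)[OF x] by (simp_all add: left_diff_distrib right_diff_distrib)
  show "(\<phi> x - d) * m = m * (\<phi> x - d)" if m: "m \<in> corner e f" for m
  proof -
    have "m * d = 0" using m d by (simp add: peirce_simps)
    then show ?thesis using M[OF m] by (simp add: algebra_simps)
  qed
  show "(\<phi> x - d) * m = m * (\<phi> x - d)" if m: "m \<in> corner f e" for m
  proof -
    have "d * m = 0" using m d by (simp add: peirce_simps)
    then show ?thesis using N[OF m] by (simp add: algebra_simps)
  qed
qed

text \<open>If \<open>\<phi> a\<close> and \<open>\<phi> b\<close> agree with \<open>da\<close> and \<open>db\<close> modulo the centre, then \<open>da * b + a * db\<close> is the
  value that a derivation would take at \<open>a * b\<close>.\<close>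

lemma corner_mod_center_mult:
  assumes a: "a \<in> corner e e" "corner_mod_center a" and b: "b \<in> corner e e" "corner_mod_center b"
  shows "corner_mod_center (a * b)"
proof -
  from a(2) b(2) obtain da db where da: "da \<in> corner e e" "\<phi> a - da \<in> center UNIV"
    and db: "db \<in> corner e e" "\<phi> b - db \<in> center UNIV" by (auto simp: corner_mod_center_def)
  have law: "\<phi> (c * m) = dc * m + c * \<phi> m"
    if c: "c \<in> corner e e" and dc: "dc \<in> corner e e" "\<phi> c - dc \<in> center UNIV" and m: "m \<in> corner e f"
    for c dc m
  proof -
    have "(\<phi> c - dc) * m = m * (\<phi> c - dc)" using dc(2) by (simp add: center_def)
    moreover have "m * dc = 0" using m dc(1) by (simp add: peirce_simps)
    ultimately show ?thesis using law_ee_ef[OF c m] by (simp add: algebra_simps)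
  qed
  have law': "\<phi> (m * c) = \<phi> m * c + m * dc"
    if c: "c \<in> corner e e" and dc: "dc \<in> corner e e" "\<phi> c - dc \<in> center UNIV" and m: "m \<in> corner f e"
    for c dc m
  proof -
    have "(\<phi> c - dc) * m = m * (\<phi> c - dc)" using dc(2) by (simp add: center_def)
    moreover have "dc * m = 0" using m dc(1) by (simp add: peirce_simps)
    ultimately have "m * \<phi> c - \<phi> c * m = m * dc" by (simp add: algebra_simps)
    then show ?thesis using law_fe_ee[OF c m] by (simp add: add_diff_eq[symmetric])
  qed
  have ab: "a * b \<in> corner e e" using a(1) b(1) by (rule corner_mult)
  show ?thesis
  proof (rule corner_mod_centerI[OF ab])
    show "da * b + a * db \<in> corner e e"
      using a(1) b(1) da(1) db(1) by (simp add: peirce_simps)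
    show "\<phi> (a * b) * m - m * \<phi> (a * b) = (da * b + a * db) * m" if m: "m \<in> corner e f" for m
    proof -
      have "b * m \<in> corner e f" using b(1) m by (simp add: peirce_simps)
      from law[OF a(1) da this] law[OF b(1) db m]
      have "\<phi> (a * b * m) = da * b * m + a * (db * m + b * \<phi> m)" by (simp add: mult.assoc)
      with law_ee_ef[OF ab m] show ?thesis by (simp add: algebra_simps)
    qed
    show "m * \<phi> (a * b) - \<phi> (a * b) * m = m * (da * b + a * db)" if m: "m \<in> corner f e" for m
    proof -
      have "m * a \<in> corner f e" using a(1) m by (simp add: peirce_simps)
      from law'[OF b(1) db this] law'[OF a(1) da m]
      have "\<phi> (m * (a * b)) = (\<phi> m * a + m * da) * b + m * a * db" by (simp add: mult.assoc)
      with law_fe_ee[OF ab m] show ?thesis by (simp add: algebra_simps)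
    qed
  qed
qed

text \<open>A derivation \<open>h\<close> has \<open>p * h p * p = 0\<close> and \<open>h p = p * h p + h p * p\<close> at an idempotent \<open>p\<close>. The
  element \<open>d\<close> below is this value, corrected by \<open>2 p (\<phi> p) p\<close>, so that a central
  summand of \<open>\<phi> p\<close> cancels.\<close>

lemma corner_mod_center_idempotent:
  assumes p: "p \<in> corner e e" and pp: "p * p = p"
  shows "corner_mod_center p"
proof (rule corner_mod_centerI[OF p])
  let ?F = "\<phi> p"
  let ?d = "p * ?F * e + e * ?F * p - (p * ?F * p + p * ?F * p)"
  have ppx: "p * (p * x) = p * x" for x using pp by (simp flip: mult.assoc)
  show "?d \<in> corner e e" using p by (intro corner_diff) (simp_all add: peirce_simps)
  show "?F * m - m * ?F = ?d * m" if m: "m \<in> corner e f" for m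
  proof -
    have pm: "p * m \<in> corner e f" using p m by (simp add: peirce_simps)
    have eFpm: "e * (?F * (p * m)) = ?F * (p * m)"
    proof -
      have "e * ?F = ?F * e" by (rule commute_of_diagonal(1)[OF phi_ee(1,2)[OF p]])
      then have "e * (?F * (p * m)) = ?F * (e * (p * m))" by (simp flip: mult.assoc)
      then show ?thesis using pm by (simp add: in_corner_iff absorbs_simps)
    qed
    \<comment> \<open>Both sides expanded by \<open>law_ee_ef\<close>; multiplying the result by \<open>p\<close> isolates \<open>p * m * \<phi> p\<close>.\<close>
    have "\<phi> (p * (p * m)) = \<phi> (p * m)" by (simp add: ppx)
    then have star: "?F * m - m * ?F = ?F * (p * m) - p * m * ?F + p * (?F * m - m * ?F)"
      unfolding law_ee_ef[OF p pm] law_ee_ef[OF p m] by (simp add: algebra_simps ppx)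
    then have "p * (?F * m - m * ?F) = p * (?F * (p * m) - p * m * ?F + p * (?F * m - m * ?F))"
      by (rule arg_cong)
    then have "p * m * ?F = p * ?F * (p * m)"
      by (simp add: algebra_simps ppx)
    with star have "?F * m - m * ?F = ?F * (p * m) + p * (?F * m) - (p * ?F * (p * m) + p * ?F * (p * m))"
      by (simp add: algebra_simps)
    also have "\<dots> = ?d * m"
      using m by (simp add: algebra_simps eFpm in_corner_iff absorbs_simps)
    finally show ?thesis .
  qed
  show "m * ?F - ?F * m = m * ?d" if m: "m \<in> corner f e" for m
  proof -
    have mp: "m * p \<in> corner f e" using p m by (simp add: peirce_simps)
    have mpFe: "m * (p * (?F * e)) = m * (p * ?F)"
    proof -
      have "e * ?F = ?F * e" by (rule commute_of_diagonal(1)[OF phi_ee(1,2)[OF p]])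
      then have "m * (p * (?F * e)) = (m * p) * e * ?F" by (simp add: mult.assoc)
      then show ?thesis using p by (simp add: in_corner_iff absorbs_simps mult.assoc)
    qed
    \<comment> \<open>Both sides expanded by \<open>law_fe_ee\<close>; multiplying the result by \<open>p\<close> isolates \<open>\<phi> p * m * p\<close>.\<close>
    have "\<phi> (m * p * p) = \<phi> (m * p)" by (simp add: mult.assoc pp)
    then have star: "m * ?F - ?F * m = (m * ?F - ?F * m) * p + (m * p * ?F - ?F * (m * p))"
      unfolding law_fe_ee[OF p mp] law_fe_ee[OF p m] by (simp add: algebra_simps pp)
    then have "(m * ?F - ?F * m) * p = ((m * ?F - ?F * m) * p + (m * p * ?F - ?F * (m * p))) * p"
      by (rule arg_cong)
    then have "?F * (m * p) = m * p * ?F * p"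
      by (simp add: algebra_simps pp)
    with star have "m * ?F - ?F * m = m * p * ?F + m * ?F * p - (m * p * ?F * p + m * p * ?F * p)"
      by (simp add: algebra_simps)
    also have "\<dots> = m * ?d"
      using m by (simp add: algebra_simps mpFe in_corner_iff absorbs_simps)
    finally show ?thesis .
  qed
qed

lemma corner_mod_center_commutator:
  assumes a: "a \<in> corner e e" and b: "b \<in> corner e e"
  shows "corner_mod_center (lie_bracket a b)"
proof -
  have "lie_bracket (\<phi> a) b = lie_bracket (e * \<phi> a * e) b"
    by (subst phi_ee(3)[OF a]) (use b in \<open>simp add: peirce_simps\<close>)
  moreover have "lie_bracket a (\<phi> b) = lie_bracket a (e * \<phi> b * e)"
    by (subst phi_ee(3)[OF b]) (use a in \<open>simp add: peirce_simps\<close>)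
  moreover have "lie_bracket (e * \<phi> a * e) b + lie_bracket a (e * \<phi> b * e) \<in> corner e e"
    using a b by (simp add: peirce_simps)
  ultimately show ?thesis
    unfolding corner_mod_center_def using defect_central[of a b]
    by (intro bexI) (simp_all add: defect_def diff_diff_eq)
qed

lemma corner_mod_center_of_generated:
  assumes gen: "corner e e = gen_idem_comm scale (corner e e)" and a: "a \<in> corner e e"
  shows "corner_mod_center a"
proof -
  let ?S = "{a \<in> corner e e. corner_mod_center a}"
  have scale_mem: "scale r x \<in> corner e e" if "x \<in> corner e e" for r x
    using that unfolding in_corner_iff
    by (simp add: absorbs_left_def absorbs_right_def scale_mult_left scale_mult_right)
  have "subspace ?S"
  proof (rule subspaceI)
    show "0 \<in> ?S" using corner_mod_center_idempotent[of 0] by (simp add: peirce_simps)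
    fix x y assume "x \<in> ?S" "y \<in> ?S"
    then obtain dx dy where xy: "x \<in> corner e e" "y \<in> corner e e"
      and d: "dx \<in> corner e e" "dy \<in> corner e e" "\<phi> x - dx \<in> center UNIV" "\<phi> y - dy \<in> center UNIV"
      by (auto simp: corner_mod_center_def)
    have "\<phi> (x + y) - (dx + dy) \<in> center UNIV"
      using center_UNIV_closed(1)[OF d(3,4)] by (simp add: phi.add algebra_simps)
    then have "corner_mod_center (x + y)"
      unfolding corner_mod_center_def by (rule bexI) (use d in \<open>simp add: peirce_simps\<close>)
    then show "x + y \<in> ?S" using xy by (simp add: peirce_simps)
  next
    fix r x assume "x \<in> ?S"
    then obtain d where x: "x \<in> corner e e" and d: "d \<in> corner e e" "\<phi> x - d \<in> center UNIV"
      by (auto simp: corner_mod_center_def)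
    have "scale r (\<phi> x - d) \<in> center UNIV"
      using d(2) by (simp add: center_def scale_mult_left scale_mult_right)
    then have "\<phi> (scale r x) - scale r d \<in> center UNIV"
      by (simp add: phi.scale scale_right_diff_distrib)
    then have "corner_mod_center (scale r x)" unfolding corner_mod_center_def using scale_mem[OF d(1)] by blast
    then show "scale r x \<in> ?S" using scale_mem[OF x] by simp
  qed
  then have "subalgebra_of scale (corner e e) ?S"
    unfolding subalgebra_of_def by (auto intro: corner_mod_center_mult corner_mult)
  moreover have "{x \<in> corner e e. x * x = x} \<union>
      {lie_bracket x y |x y. x \<in> corner e e \<and> y \<in> corner e e} \<subseteq> ?S"
    by (auto intro: corner_mod_center_idempotent corner_mod_center_commutator) (simp add: lie_bracket_def corner_mult corner_diff)
  ultimately have "gen_idem_comm scale (corner e e) \<subseteq> ?S"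
    unfolding gen_idem_comm_def by (intro hull_minimal)
  then show ?thesis using gen a by auto
qed

text \<open>If \<open>e (\<phi> b) e = e z e\<close> with \<open>z\<close> central, then \<open>\<phi> b - z\<close> lies in \<open>fAf\<close>.\<close>

lemma corner_mod_center_of_component:
  assumes center: "center (corner e e) \<subseteq> {e} * center UNIV * {e}"
    and b: "b \<in> corner f f" and x: "e * \<phi> b * e \<in> center (corner e e)"
  shows "graded_peirce_lie.corner_mod_center f \<phi> b"
proof -
  interpret s: graded_peirce_lie scale f e \<phi> n by (rule swap_graded_lie)
  from x center obtain z where z: "z \<in> center UNIV" and "e * \<phi> b * e = e * z * e"
    by (auto simp: set_times_def)
  moreover have "e * z * e = e * z" "f * z = f * z * f"
    using z by (simp_all add: center_def mult.assoc ee ff) (metis UNIV_I ee ff mult.assoc)+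
  ultimately have x: "e * \<phi> b * e = e * z" and fz: "f * z = f * z * f" by simp_all
  have "\<phi> b - z = (f * \<phi> b * f + e * \<phi> b * e) - (e + f) * z"
    by (subst s.phi_ee(3)[OF b]) (simp add: e_plus_f)
  also have "\<dots> = f * (\<phi> b - z) * f" using x fz by (simp add: distrib_right left_diff_distrib right_diff_distrib)
  finally have "\<phi> b - z \<in> corner f f" using corner_component(4) by metis
  moreover have "\<phi> b - (\<phi> b - z) \<in> center UNIV" using z by simp
  ultimately show ?thesis unfolding s.corner_mod_center_def by blast
qed

text \<open>The corners \<open>eAe\<close> and \<open>fAf\<close> commute, so the defect at \<open>(a, b)\<close> only involves the components of
  \<open>\<phi> a\<close> and \<open>\<phi> b\<close> in the foreign corner.\<close>

lemma cross_bracket: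
  assumes a: "a \<in> corner e e" and b: "b \<in> corner f f"
  shows "lie_bracket (\<phi> a) b + lie_bracket a (e * \<phi> b * e) \<in> center UNIV"
    and "n = 2 \<Longrightarrow> lie_bracket (\<phi> a) b + lie_bracket a (e * \<phi> b * e) = 0"
    and "lie_bracket (\<phi> a) b \<in> corner f f"
    and "lie_bracket a (e * \<phi> b * e) \<in> corner e e"
proof -
  interpret s: graded_peirce_lie scale f e \<phi> n by (rule swap_graded_lie)
  have "lie_bracket a b = 0" using a b by (simp add: peirce_simps)
  moreover have "lie_bracket a (\<phi> b) = lie_bracket a (e * \<phi> b * e)"
    by (subst s.phi_ee(3)[OF b]) (use a in \<open>simp add: peirce_simps\<close>)
  ultimately have eq: "lie_bracket (\<phi> a) b + lie_bracket a (e * \<phi> b * e) = - defect a b"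
    by (simp add: defect_def)
  show "lie_bracket (\<phi> a) b + lie_bracket a (e * \<phi> b * e) \<in> center UNIV"
    unfolding eq using defect_central center_UNIV_closed(3) by blast
  show "lie_bracket (\<phi> a) b + lie_bracket a (e * \<phi> b * e) = 0" if "n = 2"
    unfolding eq using phi_bracket[of a b] that by (simp add: defect_def)
  have "lie_bracket (\<phi> a) b = lie_bracket (f * \<phi> a * f) b"
    by (subst phi_ee(3)[OF a]) (use b in \<open>simp add: peirce_simps\<close>)
  then show "lie_bracket (\<phi> a) b \<in> corner f f" using b by (simp add: peirce_simps)
  show "lie_bracket a (e * \<phi> b * e) \<in> corner e e" using a by (simp add: peirce_simps)
qed

text \<open>If \<open>\<phi> a\<close> lies in \<open>eAe + Z\<close>, the part of the defect in \<open>fAf\<close> vanishes. The remaining part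
  \<open>[a, e (\<phi> b) e]\<close> is then central and lies in \<open>eAe\<close>, so it is \<open>0\<close>.\<close>

lemma corner_mod_center_transfer:
  assumes center: "center (corner e e) \<subseteq> {e} * center UNIV * {e}"
    and lifts_e: "\<And>a. a \<in> corner e e \<Longrightarrow> corner_mod_center a"
    and b: "b \<in> corner f f"
  shows "graded_peirce_lie.corner_mod_center f \<phi> b"
proof (rule corner_mod_center_of_component[OF center b])
  interpret s: graded_peirce_lie scale f e \<phi> n by (rule swap_graded_lie)
  have "a * (e * \<phi> b * e) = e * \<phi> b * e * a" if a: "a \<in> corner e e" for a
  proof -
    obtain d where d: "d \<in> corner e e" "\<phi> a - d \<in> center UNIV" using lifts_e[OF a] by (auto simp: corner_mod_center_def)
    have "lie_bracket (\<phi> a) b = lie_bracket (\<phi> a - d) b + lie_bracket d b"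
      by (simp add: lie_bracket_diff_left)
    also have "lie_bracket d b = 0" using d(1) b by (simp add: peirce_simps)
    finally have "lie_bracket a (e * \<phi> b * e) \<in> center UNIV"
      using cross_bracket(1)[OF a b] lie_bracket_center(1)[OF d(2)] by simp
    then have "lie_bracket a (e * \<phi> b * e) = 0"
      by (rule central_zero) (use cross_bracket(4)[OF a b] in \<open>simp only: in_corner_iff absorbs_simps\<close>)
    then show ?thesis by (simp add: lie_bracket_def)
  qed
  then show "e * \<phi> b * e \<in> center (corner e e)"
    by (simp add: center_def corner_component)
qed

text \<open>The commutators \<open>[a, e (\<phi> b) e]\<close> are components of central elements, hence central in \<open>eAe\<close>; for
  \<open>n = 2\<close> they vanish.\<close>

lemma corner_mod_center_of_property_P:
  assumes center: "center (corner e e) \<subseteq> {e} * center UNIV * {e}"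
    and P: "n = 2 \<or> property_P (corner e e)"
    and b: "b \<in> corner f f"
  shows "graded_peirce_lie.corner_mod_center f \<phi> b"
proof (rule corner_mod_center_of_component[OF center b])
  let ?x = "e * \<phi> b * e"
  have x: "?x \<in> corner e e" by (rule corner_component)
  have part: "e * (lie_bracket (\<phi> a) b + lie_bracket a ?x) * e = lie_bracket a ?x" if "a \<in> corner e e" for a
    using cross_bracket(3,4)[OF that b]
    by (simp only: in_corner_iff distrib_left distrib_right absorbs_simps mult_zero_left mult_zero_right add_0_left)
  show "?x \<in> center (corner e e)"
    using P
  proof
    assume "n = 2"
    then have "lie_bracket a ?x = 0" if "a \<in> corner e e" for a
      using part[OF that] cross_bracket(2)[OF that b] by simp
    then show ?thesis using x by (simp add: center_def lie_bracket_def)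
  next
    assume P: "property_P (corner e e)"
    have "lie_bracket ?x a \<in> center (corner e e)" if a: "a \<in> corner e e" for a
    proof -
      have "lie_bracket a ?x \<in> center (corner e e)"
        using central_component[OF cross_bracket(1)[OF a b]] part[OF a] by simp
      then have "- lie_bracket a ?x \<in> center (corner e e)"
        by (auto simp: center_def in_corner_iff absorbs_left_closed absorbs_right_closed)
      then show ?thesis using lie_bracket_swap[of ?x a] by simp
    qed
    then show ?thesis using P x unfolding property_P_def by blast
  qed
qed

text \<open>The components of \<open>\<phi> (exe)\<close> in \<open>fAf\<close> and of \<open>\<phi> (fxf)\<close> in \<open>eAe\<close> lift linearly to central elements
  \<open>\<theta> x\<close> and \<open>\<theta>' x\<close>. Subtracting both from \<open>\<phi>\<close> makes it preserve all corners.\<close>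

lemma derivation_mod_center:
  assumes no_ideal: "(\<forall>I. central_ideal scale (corner e e) I \<longrightarrow> I = {0}) \<or>
      (\<forall>I. central_ideal scale (corner f f) I \<longrightarrow> I = {0})"
    and lifts_e: "\<And>a. a \<in> corner e e \<Longrightarrow> corner_mod_center a"
    and lifts_f: "\<And>b. b \<in> corner f f \<Longrightarrow> graded_peirce_lie.corner_mod_center f \<phi> b"
  shows "\<exists>h. derivation scale h \<and> range (\<lambda>x. \<phi> x - h x) \<subseteq> center UNIV"
proof -
  interpret s: graded_peirce_lie scale f e \<phi> n by (rule swap_graded_lie)
  have sandwich: "module_hom scale scale (\<lambda>x. p * \<phi> (q * x * q) * p)" for p q
    by unfold_locales (simp_all add: phi.add phi.scale scale_mult_left scale_mult_right algebra_simps)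
  have "\<exists>z \<in> center UNIV. f * z = f * \<phi> (e * x * e) * f" for x
  proof -
    let ?a = "e * x * e"
    obtain d where d: "d \<in> corner e e" "\<phi> ?a - d \<in> center UNIV"
      using lifts_e[OF corner_component(1)] by (auto simp: corner_mod_center_def)
    have "f * (\<phi> ?a - d) = f * \<phi> ?a * f"
      using d(1) commute_of_diagonal(2)[OF phi_ee(1,2)[OF corner_component(1)], of x]
      by (simp add: right_diff_distrib in_corner_iff absorbs_simps) (metis ff mult.assoc)
    with d(2) show ?thesis by blast
  qed
  from central_lift[OF sandwich this] obtain \<theta> where
    \<theta>: "module_hom scale scale \<theta>" "range \<theta> \<subseteq> center UNIV" and f\<theta>: "\<And>x. f * \<theta> x = f * \<phi> (e * x * e) * f"
    by blast
  have "\<exists>z \<in> center UNIV. e * z = e * \<phi> (f * x * f) * e" for x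
  proof -
    let ?b = "f * x * f"
    obtain d where d: "d \<in> corner f f" "\<phi> ?b - d \<in> center UNIV"
      using lifts_f[OF corner_component(4)] by (auto simp: s.corner_mod_center_def)
    have "e * (\<phi> ?b - d) = e * \<phi> ?b * e"
      using d(1) commute_of_diagonal(1)[OF s.phi_ee(2,1)[OF corner_component(4)], of x]
      by (simp add: right_diff_distrib in_corner_iff absorbs_simps) (metis ee mult.assoc)
    with d(2) show ?thesis by blast
  qed
  from s.central_lift[OF sandwich this] obtain \<theta>' where
    \<theta>': "module_hom scale scale \<theta>'" "range \<theta>' \<subseteq> center UNIV" and e\<theta>': "\<And>x. e * \<theta>' x = e * \<phi> (f * x * f) * e"
    by blast
  interpret th: module_hom scale scale \<theta> by (rule \<theta>(1))
  interpret th': module_hom scale scale \<theta>' by (rule \<theta>'(1))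
  have mem: "\<theta> x \<in> center UNIV" "\<theta>' x \<in> center UNIV" for x using \<theta>(2) \<theta>'(2) by auto
  have comm: "\<theta> x * y = y * \<theta> x" "\<theta>' x * y = y * \<theta>' x" for x y
    using mem[of x] by (auto simp: center_def)
  have \<theta>_zero: "\<theta> x = 0" if "e * x * e = 0" for x
    by (rule central_zero[OF mem(1)]) (simp add: f\<theta> that)
  have \<theta>'_zero: "\<theta>' x = 0" if "f * x * f = 0" for x
    by (rule s.central_zero[OF mem(2)]) (simp add: e\<theta>' that)
  define h where "h x = \<phi> x - \<theta> x - \<theta>' x" for x
  have hom: "module_hom scale scale h"
    by unfold_locales
      (simp_all add: h_def phi.add th.add th'.add phi.scale th.scale th'.scale scale_right_diff_distrib)
  interpret hom: module_hom scale scale h by (rule hom)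
  interpret g: graded_lie_mod_center scale e f h
  proof
    show "h (x + y) = h x + h y" for x y by (rule hom.add)
    show "h x \<in> corner e e" if x: "x \<in> corner e e" for x
    proof -
      have z: "f * x * f = 0" and exe: "e * x * e = x" using x by (simp_all add: peirce_simps)
      have h: "h x = \<phi> x - \<theta> x" by (simp add: h_def \<theta>'_zero[OF z])
      have "f * \<theta> x * f = f * \<theta> x" by (simp add: f\<theta> mult.assoc ff)
      then have "f * h x * f = 0" unfolding h right_diff_distrib left_diff_distrib
        using f\<theta>[of x] by (simp add: exe)
      moreover have "e * \<theta> x * f = \<theta> x * (e * f)" "f * \<theta> x * e = \<theta> x * (f * e)"
        by (simp_all add: comm mult.assoc)
      then have "e * h x * f = 0" "f * h x * e = 0"
        unfolding h right_diff_distrib left_diff_distrib phi_ee(1,2)[OF x] by (simp_all add: ef fe)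
      ultimately have "h x = e * h x * e" using peirce_sum[of "h x"] by simp
      then show ?thesis using corner_component(1) by metis
    qed
    show "h x \<in> corner f f" if x: "x \<in> corner f f" for x
    proof -
      have z: "e * x * e = 0" and fxf: "f * x * f = x" using x by (simp_all add: peirce_simps)
      have h: "h x = \<phi> x - \<theta>' x" by (simp add: h_def \<theta>_zero[OF z])
      have "e * \<theta>' x * e = e * \<theta>' x" by (simp add: e\<theta>' mult.assoc ee)
      then have "e * h x * e = 0" unfolding h right_diff_distrib left_diff_distrib
        using e\<theta>'[of x] by (simp add: fxf)
      moreover have "e * \<theta>' x * f = \<theta>' x * (e * f)" "f * \<theta>' x * e = \<theta>' x * (f * e)"
        by (simp_all add: comm mult.assoc)
      then have "e * h x * f = 0" "f * h x * e = 0"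
        unfolding h right_diff_distrib left_diff_distrib s.phi_ee(1,2)[OF x] by (simp_all add: ef fe)
      ultimately have "h x = f * h x * f" using peirce_sum[of "h x"] by simp
      then show ?thesis using corner_component(4) by metis
    qed
    show "h x \<in> corner e f" if "x \<in> corner e f" for x
      using phi_ef_mem[OF that] that by (simp add: h_def \<theta>_zero \<theta>'_zero peirce_simps)
    show "h x \<in> corner f e" if "x \<in> corner f e" for x
      using phi_fe_mem[OF that] that by (simp add: h_def \<theta>_zero \<theta>'_zero peirce_simps)
    show "h (lie_bracket x y) - lie_bracket (h x) y - lie_bracket x (h y) \<in> center UNIV" for x y
    proof -
      have "h (lie_bracket x y) - lie_bracket (h x) y - lie_bracket x (h y)
          = defect x y - \<theta> (lie_bracket x y) - \<theta>' (lie_bracket x y)"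
        by (simp add: h_def defect_def lie_bracket_diff_left lie_bracket_diff_right lie_bracket_center mem)
      then show ?thesis using defect_central mem by (simp add: center_UNIV_closed)
    qed
  qed
  have "derivation scale h" unfolding derivation_def using hom g.leibniz[OF no_ideal] by blast
  moreover have "\<phi> x - h x \<in> center UNIV" for x
    using center_UNIV_closed(1)[OF mem(2,1), of x x] by (simp add: h_def)
  ultimately show ?thesis by blast
qed

end

section \<open>Standard form\<close>

lemma singleton_times_corner:
  "{x} * corner p q = {0} \<longleftrightarrow> (\<forall>y \<in> corner p q. x * y = 0)"
  "corner p q * {x} = {0} \<longleftrightarrow> (\<forall>y \<in> corner p q. y * x = 0)"
  for x :: "'a::ring_1"
proof -
  have "p * 0 * q \<in> corner p q" unfolding corner_def by blast
  then show "{x} * corner p q = {0} \<longleftrightarrow> (\<forall>y \<in> corner p q. x * y = 0)"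
    "corner p q * {x} = {0} \<longleftrightarrow> (\<forall>y \<in> corner p q. y * x = 0)"
    by (auto simp: set_times_def)
qed

theorem corollary2p18:
  fixes scale :: "'r::comm_ring_1 \<Rightarrow> 'a::ring_1 \<Rightarrow> 'a"
    and e f :: 'a and n :: nat
  assumes "n \<ge> 2"
    and "unital_algebra scale"
    and "e * e = e" "e \<noteq> 0" "e \<noteq> 1"
    and "f = 1 - e"
    and "torsion_free 2 TYPE('a)" "torsion_free (n - 1) TYPE('a)"
    and "\<And>x. {e * x * e} * corner e f = {0} \<Longrightarrow> corner f e * {e * x * e} = {0} \<Longrightarrow> e * x * e = 0"
    and "\<And>x. corner e f * {f * x * f} = {0} \<Longrightarrow> {f * x * f} * corner f e = {0} \<Longrightarrow> f * x * f = 0"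
    and i: "(corner e e = gen_idem_comm scale (corner e e) \<and>
             corner f f = gen_idem_comm scale (corner f f)) \<or>
            (corner e e = gen_idem_comm scale (corner e e) \<and>
             center (corner e e) = {e} * center UNIV * {e}) \<or>
            (corner f f = gen_idem_comm scale (corner f f) \<and>
             center (corner f f) = {f} * center UNIV * {f}) \<or>
            (center (corner e e) = {e} * center UNIV * {e} \<and>
             center (corner f f) = {f} * center UNIV * {f} \<and>
             (n \<ge> 3 \<longrightarrow> property_P (corner e e) \<or> property_P (corner f f)))"
    and ii: "((\<forall>I. central_ideal scale (corner e e) I \<longrightarrow> I = {0}) \<or>
              (\<forall>I. central_ideal scale (corner f f) I \<longrightarrow> I = {0})) \<or>
             (corner e f * corner f e = {0} \<and> corner f e * corner e f = {0})"
    and iii: "\<And>x. {e * x * f} * corner f e = {0} \<Longrightarrow> corner f e * {e * x * f} = {0} \<Longrightarrow> e * x * f = 0"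
      "\<And>x. corner e f * {f * x * e} = {0} \<Longrightarrow> {f * x * e} * corner e f = {0} \<Longrightarrow> f * x * e = 0"
  shows "\<forall>\<phi>. lie_n_derivation scale n \<phi> \<longrightarrow> standard scale n \<phi>"
proof (intro allI impI)
  fix \<phi>\<^sub>0 assume lie0: "lie_n_derivation scale n \<phi>\<^sub>0"
  interpret unital_algebra scale by (rule assms(2))
  interpret peirce scale e f
    by unfold_locales (simp_all add: assms(3,6) algebra_simps)
  interpret faithful_peirce scale e f
  proof
    fix a assume a: "a \<in> corner e e"
      and "\<And>m. m \<in> corner e f \<Longrightarrow> a * m = 0" "\<And>m. m \<in> corner f e \<Longrightarrow> m * a = 0"
    moreover have "e * a * e = a" using a by (simp add: peirce_simps)
    ultimately show "a = 0" using assms(9)[of a] by (simp add: singleton_times_corner)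
  next
    fix b assume b: "b \<in> corner f f"
      and "\<And>m. m \<in> corner f e \<Longrightarrow> b * m = 0" "\<And>m. m \<in> corner e f \<Longrightarrow> m * b = 0"
    moreover have "f * b * f = b" using b by (simp add: peirce_simps)
    ultimately show "b = 0" using assms(10)[of b] by (simp add: singleton_times_corner)
  qed
  have ef_zero: "m = 0" if "m \<in> corner e f" "\<And>y. y \<in> corner f e \<Longrightarrow> m * y = 0"
    "\<And>y. y \<in> corner f e \<Longrightarrow> y * m = 0" for m
  proof -
    have "e * m * f = m" using that(1) by (simp add: peirce_simps)
    then show ?thesis using iii(1)[of m] that(2,3) by (simp add: singleton_times_corner)
  qed
  have fe_zero: "m = 0" if "m \<in> corner f e" "\<And>y. y \<in> corner e f \<Longrightarrow> y * m = 0"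
    "\<And>y. y \<in> corner e f \<Longrightarrow> m * y = 0" for m
  proof -
    have "f * m * e = m" using that(1) by (simp add: peirce_simps)
    then show ?thesis using iii(2)[of m] that(2,3) by (simp add: singleton_times_corner)
  qed
  \<comment> \<open>If all products between \<open>eAf\<close> and \<open>fAe\<close> vanished, both corners would be \<open>0\<close>
      by nondegeneracy, and \<open>e\<close>, acting as \<open>0\<close> on them, would be \<open>0\<close>.\<close>
  have no_ideal: "(\<forall>I. central_ideal scale (corner e e) I \<longrightarrow> I = {0}) \<or>
      (\<forall>I. central_ideal scale (corner f f) I \<longrightarrow> I = {0})"
  proof (rule ccontr)
    assume "\<not> ?thesis"
    with ii have "corner e f * corner f e = {0}" "corner f e * corner e f = {0}" by auto
    then have "x * y = 0" "y * x = 0" if "x \<in> corner e f" "y \<in> corner f e" for x y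
      using that set_times_intro[of x "corner e f" y "corner f e"]
        set_times_intro[of y "corner f e" x "corner e f"] by auto
    then have zero: "m = 0" if "m \<in> corner e f \<or> m \<in> corner f e" for m
      using that ef_zero[of m] fe_zero[of m] by blast
    have "e = 0"
    proof (rule faithful_e)
      show "e \<in> corner e e" by (simp add: peirce_simps)
      show "e * m = 0" if "m \<in> corner e f" for m
        using zero[of m] that by simp
      show "m * e = 0" if "m \<in> corner f e" for m
        using zero[of m] that by simp
    qed
    with assms(4) show False ..
  qed
  \<comment> \<open>The inner derivation \<open>[\<cdot>, t]\<close> has the same off-diagonal components at \<open>e\<close> as \<open>\<phi>\<^sub>0\<close>.\<close>
  define t where "t = lie_bracket e (\<phi>\<^sub>0 e)"
  define \<phi> where "\<phi> x = \<phi>\<^sub>0 x - lie_bracket x t" for x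
  have lie': "lie_n_derivation scale n \<phi>"
    unfolding \<phi>_def using assms(1) by (intro lie_n_derivation_diff[OF lie0 inner_derivation]) simp
  interpret peirce_lie scale e f \<phi> n
  proof
    show "e * \<phi> e * f = 0" "f * \<phi> e * e = 0"
      by (simp_all add: \<phi>_def t_def peirce_simps)
  qed (fact lie' assms(1,7,8))+
  interpret s: peirce_lie scale f e \<phi> n by (rule swap_lie)
  interpret graded_peirce_lie scale e f \<phi> n
  proof
    show "\<phi> m \<in> corner e f" if "m \<in> corner e f" for m
      using no_ideal fe_zero that by (rule phi_ef_preserved)
    show "\<phi> m \<in> corner f e" if "m \<in> corner f e" for m
      using no_ideal[THEN disj_commute[THEN iffD1]] ef_zero that by (rule s.phi_ef_preserved)
  qed
  interpret s: graded_peirce_lie scale f e \<phi> n by (rule swap_graded_lie)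
  have "(\<forall>a \<in> corner e e. corner_mod_center a) \<and> (\<forall>b \<in> corner f f. s.corner_mod_center b)"
    using i
  proof (elim disjE conjE)
    assume gen: "corner e e = gen_idem_comm scale (corner e e)" "corner f f = gen_idem_comm scale (corner f f)"
    show ?thesis using corner_mod_center_of_generated[OF gen(1)] s.corner_mod_center_of_generated[OF gen(2)] by blast
  next
    assume gen: "corner e e = gen_idem_comm scale (corner e e)"
      and center: "center (corner e e) = {e} * center UNIV * {e}"
    show ?thesis using corner_mod_center_of_generated[OF gen] corner_mod_center_transfer[OF eq_refl[OF center]] by blast
  next
    assume gen: "corner f f = gen_idem_comm scale (corner f f)"
      and center: "center (corner f f) = {f} * center UNIV * {f}"
    show ?thesis using s.corner_mod_center_of_generated[OF gen] s.corner_mod_center_transfer[OF eq_refl[OF center]] by blast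
  next
    assume ce: "center (corner e e) = {e} * center UNIV * {e}"
      and cf: "center (corner f f) = {f} * center UNIV * {f}"
      and P: "n \<ge> 3 \<longrightarrow> property_P (corner e e) \<or> property_P (corner f f)"
    from P assms(1) consider "n = 2 \<or> property_P (corner e e)" | "n = 2 \<or> property_P (corner f f)" by linarith
    then show ?thesis
    proof cases
      case 1
      then show ?thesis
        using corner_mod_center_of_property_P[OF eq_refl[OF ce]] s.corner_mod_center_transfer[OF eq_refl[OF cf]] by blast
    next
      case 2
      then show ?thesis
        using s.corner_mod_center_of_property_P[OF eq_refl[OF cf]] corner_mod_center_transfer[OF eq_refl[OF ce]] by blast
    qed
  qed
  then obtain h where h: "derivation scale h" "range (\<lambda>x. \<phi> x - h x) \<subseteq> center UNIV"
    using derivation_mod_center[OF no_ideal] by blast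
  show "standard scale n \<phi>\<^sub>0"
  proof (rule standardI[OF lie0 assms(1)])
    show "derivation scale (\<lambda>x. h x + lie_bracket x t)"
      by (rule derivation_add[OF h(1) inner_derivation])
    show "range (\<lambda>x. \<phi>\<^sub>0 x - (h x + lie_bracket x t)) \<subseteq> center UNIV"
      using h(2) by (simp add: \<phi>_def algebra_simps)
  qed
qed

end
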